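(* Assume the system is regular, linearly parametrized, open-loop exponentially stable, and satisfies the setpoint conditions (all as defined in the context). Let $\omega\ge 1$, $M\ge 1$, $N\ge 1$ be such that there is $\alpha>0$ with $$\mathcal{J}_N^\star(f(x,\pi(x,\theta),\theta,0),\theta)-\mathcal{J}_N^\star(x,\theta)\le-\alpha\,\ell(x,\pi(x,\theta),x^\star_{\mathrm{s},x,\theta},u^\star_{\mathrm{s},x,\theta})\quad\text{for all }(x,\theta)\in\mathbb{R}^{n_x}\times\Theta.$$ Then there exist constants $\rho_V\in(0,1)$, $c_V>0$ such that for any parameter estimates $\hat\theta_k\in\Theta$, parameters $\theta_k\in\Theta$, disturbances $w_k\in\mathbb{R}^{n_w}$, noise $v_k\in\mathbb{R}^{n_x}$, $k\ge0$, and any $x_0\in\mathbb{R}^{n_x}$, the closed-loop system $x_{k+1}=f(x_k,u_k,\theta_k,w_k)$, $u_k=\pi(\hat x_k,\hat\theta_k)$, $\hat x_k=x_k+v_k$ satisfies for all $k\ge0$ $$\mathcal{J}_N^\star(\hat x_{k+1},\hat\theta_{k+1})\le\rho_V\mathcal{J}_N^\star(\hat x_k,\hat\theta_k)+c_V\left(\|\tilde w_k+\tilde x_{1|k}\|^2+\|\hat\theta_{k+1}-\hat\theta_k\|^2\right),$$ where $\tilde x_{1|k}=G(\hat x_k,u_k,0)(\theta_k-\hat\theta_k)$ and $\tilde w_k=\hat x_{k+1}-f(\hat x_k,u_k,\theta_k,0)$.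
   Context: Notation: $\|\cdot\|$ is the Euclidean norm, $\|z\|_P=\sqrt{z^\top Pz}$ for $P\succ0$. Data: $f:\mathbb{R}^{n_x}\times\mathbb{R}^{n_u}\times\mathbb{R}^{n_\theta}\times\mathbb{R}^{n_w}\to\mathbb{R}^{n_x}$, $h:\mathbb{R}^{n_x}\times\mathbb{R}^{n_u}\times\mathbb{R}^{n_\theta}\to\mathbb{R}^{n_y}$, compact $\mathbb{U}\subset\mathbb{R}^{n_u}$, $\Theta\subset\mathbb{R}^{n_\theta}$, $\mathbb{X}=\{x\in\mathbb{R}^{n_x}: D_ix\le d_i,\ i=1,\dots,r\}$, target $y_{\mathrm d}\in\mathbb{R}^{n_y}$, positive definite $Q,R,T$, weights $q_{\xi,i}>0$. Setpoints: $\mathbb{S}(\theta)=\{(x,u,y)\in\mathbb{X}\times\mathbb{U}\times\mathbb{R}^{n_y}: f(x,u,\theta,0)=x,\ y=h(x,u,\theta)\}$, and $(x_{\mathrm{rd},\theta},u_{\mathrm{rd},\theta},y_{\mathrm{rd},\theta})\in\arg\min_{(x,u,y)\in\mathbb{S}(\theta)}\|y_{\mathrm d}-y\|_T^2$. Regular: $\mathbb{S}(\theta)$ is non-empty, closed and uniformly bounded for $\theta\in\Theta$; $f,h$ are continuously differentiable and Lipschitz continuous with constants $L_f,L_h$ (arguments $x\in\mathbb{R}^{n_x},u\in\mathbb{U},\theta\in\Theta,w\in\mathbb{R}^{n_w}$); $\mathbb{U},\Theta$ are convex and compact. Linearly parametrized: $f(x,u,\theta,w)=f(x,u,0,w)+G(x,u,w)\theta$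 for a matrix-valued $G$. Setpoint conditions: (i) there are functions $g_{y,x}:\mathbb{R}^{n_y}\times\Theta\to\mathbb{R}^{n_x}$, $g_{y,u}:\mathbb{R}^{n_y}\times\Theta\to\mathbb{R}^{n_u}$ such that $x=g_{y,x}(y,\theta)$, $u=g_{y,u}(y,\theta)$ for all $\theta\in\Theta$, $(x,u,y)\in\mathbb{S}(\theta)$, and $L_g\ge0$ with $\|g_{y,x}(y,\theta)-g_{y,x}(\tilde y,\tilde\theta)\|_Q^2+\|g_{y,u}(y,\theta)-g_{y,u}(\tilde y,\tilde\theta)\|_R^2\le L_g(\|y-\tilde y\|_T^2+\|\theta-\tilde\theta\|^2)$ for all $y,\tilde y\in\mathbb{R}^{n_y}$, $\theta,\tilde\theta\in\Theta$; (ii) for $\theta\in\Theta$, $(x_1,u_1,y_1),(x_2,u_2,y_2)\in\mathbb{S}(\theta)$, $\beta\in[0,1]$, $\tilde y=\beta y_1+(1-\beta)y_2$ satisfies $(g_{y,x}(\tilde y,\theta),g_{y,u}(\tilde y,\theta),\tilde y)\in\mathbb{S}(\theta)$; (iii) $y_{\mathrm{rd},\theta}=y_{\mathrm d}$ for all $\theta\in\Theta$; (iv) there is $L_s\ge 0$ such that for all $\theta,\tilde\theta\in\Theta$, $(x_s,u_s,y_s)\in\mathbb{S}(\theta)$: $\min_{(\tilde x_s,\tilde u_s,\tilde y_s)\in\mathbb{S}(\tilde\theta)}\|y_s-\tilde y_s\|_T^2\le L_s\|\theta-\tilde\theta\|^2$. Predictions: for $\mathbf{u}=(\mathbf{u}_0,\dots,\mathbf{u}_{m-1})\in\mathbb{U}^m$,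 $x_{\mathbf u}(k,x,\theta)$ is the solution after $k$ steps of $z_{k+1}=f(z_k,\mathbf{u}_k,\theta,0)$, $z_0=x$; $\mathbf{u}_{\mathrm s}^m$ is the constant sequence $(u_{\mathrm s},\dots,u_{\mathrm s})\in\mathbb{U}^m$. Open-loop exponentially stable: there are $C_\rho\ge1$, $\rho\in(0,1)$ such that for all $\theta\in\Theta$, all $(x_s,u_s)\in\mathbb{R}^{n_x}\times\mathbb{U}$ with $x_s=f(x_s,u_s,\theta,0)$, all $x\in\mathbb{R}^{n_x}$, $k\ge0$: $\|x_{\mathbf{u}_s^k}(k,x,\theta)-x_s\|\le C_\rho\rho^k\|x-x_s\|$. MPC: $\ell(x,u,x_s,u_s)=\|x-x_s\|_Q^2+\|u-u_s\|_R^2+\sum_{i=1}^rq_{\xi,i}\max\{D_ix-d_i,0\}^2$; $V_f(x,x_s,u_s,\theta)=\sum_{k=0}^{M-1}\ell(x_{\mathbf{u}_s^M}(k,x,\theta),u_s,x_s,u_s)$; $\mathcal{J}_N(x,\theta,\mathbf{u},x_s,u_s)=\sum_{k=0}^{N-1}\ell(x_{\mathbf u}(k,x,\theta),\mathbf{u}_k,x_s,u_s)+\omega V_f(x_{\mathbf u}(N,x,\theta),x_s,u_s,\theta)$. $\mathcal{J}_N^\star(x,\theta)$ is the minimum of $\mathcal{J}_N(x,\theta,\mathbf{u},x_s,u_s)+\|y_s-y_{\mathrm d}\|_T^2$ over $\mathbf{u}\in\mathbb{U}^N$, $(x_s,u_s,y_s)\in\mathbb{S}(\theta)$; a minimizer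 $\mathbf{u}^\star_{x,\theta},(x^\star_{\mathrm{s},x,\theta},u^\star_{\mathrm{s},x,\theta},y^\star_{\mathrm{s},x,\theta})$ is fixed for every $(x,\theta)$, and $\pi(x,\theta)\in\mathbb{U}$ is the first element of $\mathbf{u}^\star_{x,\theta}$. *)

theory Defs
  imports "HOL-Analysis.Analysis"
begin

definition pos_def :: "real^'n^'n \<Rightarrow> bool" where
  "pos_def P \<longleftrightarrow> transpose P = P \<and> (\<forall>z. z \<noteq> 0 \<longrightarrow> 0 < z \<bullet> (P *v z))"

definition wnorm :: "real^'n^'n \<Rightarrow> real^'n \<Rightarrow> real" where
  "wnorm P z = sqrt (z \<bullet> (P *v z))"

text \<open>
  Continuous differentiability relative to a set: one-sided derivatives at boundary points of
  \<open>S\<close> suffice, which is weaker than being C1 on an open neighbourhood of \<open>S\<close>.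
\<close>

definition C1_on ::
  "('a::real_normed_vector \<Rightarrow> 'b::real_normed_vector) \<Rightarrow> 'a set \<Rightarrow> bool" where
  "C1_on F S \<longleftrightarrow>
     (\<exists>F' :: 'a \<Rightarrow> 'a \<Rightarrow>\<^sub>L 'b.
        (\<forall>z\<in>S. (F has_derivative blinfun_apply (F' z)) (at z within S)) \<and> continuous_on S F')"

text \<open>
  The problem data. State, input, parameter, disturbance and output dimensions are the
  cardinalities of the types \<open>'nx\<close>, \<open>'nu\<close>, \<open>'nt\<close>, \<open>'nw\<close>, \<open>'ny\<close>. The state constraints are
  \<open>Drow i \<bullet> x \<le> dbnd i\<close> for \<open>i = 1, \<dots>, ncon\<close>; \<open>ncon = 0\<close> (no constraints) is allowed, and the
  values of \<open>Drow\<close>, \<open>dbnd\<close>, \<open>qxi\<close> outside \<open>{1..ncon}\<close> play no role.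
\<close>

record ('nx, 'nu, 'nt, 'nw, 'ny) mpc_data =
  dyn :: "(real^'nx) \<times> (real^'nu) \<times> (real^'nt) \<times> (real^'nw) \<Rightarrow> real^'nx"
  outp :: "(real^'nx) \<times> (real^'nu) \<times> (real^'nt) \<Rightarrow> real^'ny"
  Uset :: "(real^'nu) set"
  Thetas :: "(real^'nt) set"
  ncon :: nat
  Drow :: "nat \<Rightarrow> real^'nx"
  dbnd :: "nat \<Rightarrow> real"
  ytarget :: "real^'ny"
  Qmat :: "real^'nx^'nx"
  Rmat :: "real^'nu^'nu"
  Tmat :: "real^'ny^'ny"
  qxi :: "nat \<Rightarrow> real"

definition Xset ::
  "('nx::finite, 'nu::finite, 'nt::finite, 'nw::finite, 'ny::finite) mpc_data
    \<Rightarrow> (real^'nx) set" where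
  "Xset P = {x. \<forall>i\<in>{1..ncon P}. Drow P i \<bullet> x \<le> dbnd P i}"

definition setpoints ::
  "('nx::finite, 'nu::finite, 'nt::finite, 'nw::finite, 'ny::finite) mpc_data
    \<Rightarrow> real^'nt
    \<Rightarrow> ((real^'nx) \<times> (real^'nu) \<times> (real^'ny)) set" where
  "setpoints P \<theta> =
     {(x, u, y). x \<in> Xset P \<and> u \<in> Uset P \<and> dyn P (x, u, \<theta>, 0) = x \<and> y = outp P (x, u, \<theta>)}"

definition optimal_setpoint ::
  "('nx::finite, 'nu::finite, 'nt::finite, 'nw::finite, 'ny::finite) mpc_data
    \<Rightarrow> real^'nt
    \<Rightarrow> (real^'nx) \<times> (real^'nu) \<times> (real^'ny) \<Rightarrow> bool" where
  "optimal_setpoint P \<theta> s \<longleftrightarrow>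
     is_arg_min (\<lambda>(x, u, y). (wnorm (Tmat P) (ytarget P - y))\<^sup>2) (\<lambda>s. s \<in> setpoints P \<theta>) s"

definition regular ::
  "('nx::finite, 'nu::finite, 'nt::finite, 'nw::finite, 'ny::finite) mpc_data
    \<Rightarrow> bool" where
  "regular P \<longleftrightarrow>
     (\<forall>\<theta>\<in>Thetas P. setpoints P \<theta> \<noteq> {} \<and> closed (setpoints P \<theta>)) \<and>
     bounded (\<Union>\<theta>\<in>Thetas P. setpoints P \<theta>) \<and>
     C1_on (dyn P) (UNIV \<times> Uset P \<times> Thetas P \<times> UNIV) \<and>
     C1_on (outp P) (UNIV \<times> Uset P \<times> Thetas P) \<and>
     (\<exists>L_f. L_f-lipschitz_on (UNIV \<times> Uset P \<times> Thetas P \<times> UNIV) (dyn P)) \<and>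
     (\<exists>L_h. L_h-lipschitz_on (UNIV \<times> Uset P \<times> Thetas P) (outp P)) \<and>
     convex (Uset P) \<and> compact (Uset P) \<and> convex (Thetas P) \<and> compact (Thetas P)"

definition linearly_parametrized ::
  "('nx::finite, 'nu::finite, 'nt::finite, 'nw::finite, 'ny::finite) mpc_data
    \<Rightarrow> (real^'nx \<Rightarrow> real^'nu \<Rightarrow> real^'nw \<Rightarrow> real^'nt^'nx) \<Rightarrow> bool" where
  "linearly_parametrized P G \<longleftrightarrow>
     (\<forall>x u \<theta> w. dyn P (x, u, \<theta>, w) = dyn P (x, u, 0, w) + G x u w *v \<theta>)"

text \<open>
  The last argument is the output component of the optimal setpoint, as a function of the
  parameter. The infimum in the final conjunct is a minimum whenever the sets of setpoints are
  non-empty and compact, as for regular systems.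
\<close>

definition setpoint_conditions ::
  "('nx::finite, 'nu::finite, 'nt::finite, 'nw::finite, 'ny::finite) mpc_data
    \<Rightarrow> (real^'nt \<Rightarrow> real^'ny) \<Rightarrow> bool" where
  "setpoint_conditions P yrd \<longleftrightarrow>
     (\<exists>(gx :: real^'ny \<Rightarrow> real^'nt \<Rightarrow> real^'nx) (gu :: real^'ny \<Rightarrow> real^'nt \<Rightarrow> real^'nu).
        (\<forall>\<theta>\<in>Thetas P. \<forall>(x, u, y)\<in>setpoints P \<theta>. x = gx y \<theta> \<and> u = gu y \<theta>) \<and>
        (\<exists>L_g\<ge>0. \<forall>y y'. \<forall>\<theta>\<in>Thetas P. \<forall>\<theta>'\<in>Thetas P.
           (wnorm (Qmat P) (gx y \<theta> - gx y' \<theta>'))\<^sup>2 + (wnorm (Rmat P) (gu y \<theta> - gu y' \<theta>'))\<^sup>2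
             \<le> L_g * ((wnorm (Tmat P) (y - y'))\<^sup>2 + (norm (\<theta> - \<theta>'))\<^sup>2)) \<and>
        (\<forall>\<theta>\<in>Thetas P. \<forall>(x1, u1, y1)\<in>setpoints P \<theta>. \<forall>(x2, u2, y2)\<in>setpoints P \<theta>.
           \<forall>\<beta>\<in>{0..1}. let y = \<beta> *\<^sub>R y1 + (1 - \<beta>) *\<^sub>R y2
             in (gx y \<theta>, gu y \<theta>, y) \<in> setpoints P \<theta>)) \<and>
     (\<forall>\<theta>\<in>Thetas P. yrd \<theta> = ytarget P) \<and>
     (\<exists>L_s\<ge>0. \<forall>\<theta>\<in>Thetas P. \<forall>\<theta>'\<in>Thetas P. \<forall>(xs, us, ys)\<in>setpoints P \<theta>.
        (INF (xs', us', ys')\<in>setpoints P \<theta>'. (wnorm (Tmat P) (ys - ys'))\<^sup>2)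
          \<le> L_s * (norm (\<theta> - \<theta>'))\<^sup>2)"

text \<open>
  Finite input sequences are represented by functions on \<open>nat\<close>; \<open>pred_state P u k\<close> only
  depends on the entries \<open>u 0, \<dots>, u (k - 1)\<close>.
\<close>

primrec pred_state ::
  "('nx::finite, 'nu::finite, 'nt::finite, 'nw::finite, 'ny::finite) mpc_data
    \<Rightarrow> (nat \<Rightarrow> real^'nu) \<Rightarrow> nat \<Rightarrow> real^'nx \<Rightarrow> real^'nt
    \<Rightarrow> real^'nx" where
  "pred_state P u 0 x \<theta> = x"
| "pred_state P u (Suc k) x \<theta> = dyn P (pred_state P u k x \<theta>, u k, \<theta>, 0)"

definition open_loop_exp_stable ::
  "('nx::finite, 'nu::finite, 'nt::finite, 'nw::finite, 'ny::finite) mpc_data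
    \<Rightarrow> bool" where
  "open_loop_exp_stable P \<longleftrightarrow>
     (\<exists>C\<ge>1. \<exists>\<rho>\<in>{0<..<1}. \<forall>\<theta>\<in>Thetas P. \<forall>xs. \<forall>us\<in>Uset P. xs = dyn P (xs, us, \<theta>, 0) \<longrightarrow>
        (\<forall>x k. norm (pred_state P (\<lambda>_. us) k x \<theta> - xs) \<le> C * \<rho> ^ k * norm (x - xs)))"

definition stage_cost ::
  "('nx::finite, 'nu::finite, 'nt::finite, 'nw::finite, 'ny::finite) mpc_data
    \<Rightarrow> real^'nx \<Rightarrow> real^'nu \<Rightarrow> real^'nx \<Rightarrow> real^'nu
    \<Rightarrow> real" where
  "stage_cost P x u xs us =
     (wnorm (Qmat P) (x - xs))\<^sup>2 + (wnorm (Rmat P) (u - us))\<^sup>2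
     + (\<Sum>i=1..ncon P. qxi P i * (max (Drow P i \<bullet> x - dbnd P i) 0)\<^sup>2)"

definition terminal_cost ::
  "('nx::finite, 'nu::finite, 'nt::finite, 'nw::finite, 'ny::finite) mpc_data
    \<Rightarrow> nat \<Rightarrow> real^'nx \<Rightarrow> real^'nx \<Rightarrow> real^'nu \<Rightarrow> real^'nt
    \<Rightarrow> real" where
  "terminal_cost P M x xs us \<theta> =
     (\<Sum>k<M. stage_cost P (pred_state P (\<lambda>_. us) k x \<theta>) us xs us)"

definition horizon_cost ::
  "('nx::finite, 'nu::finite, 'nt::finite, 'nw::finite, 'ny::finite) mpc_data
    \<Rightarrow> nat \<Rightarrow> real \<Rightarrow> nat \<Rightarrow> real^'nx \<Rightarrow> real^'nt
    \<Rightarrow> (nat \<Rightarrow> real^'nu) \<Rightarrow> real^'nx \<Rightarrow> real^'nu \<Rightarrow> real" where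
  "horizon_cost P M \<omega> N x \<theta> u xs us =
     (\<Sum>k<N. stage_cost P (pred_state P u k x \<theta>) (u k) xs us)
     + \<omega> * terminal_cost P M (pred_state P u N x \<theta>) xs us \<theta>"

text \<open>
  The constraint that the input sequence lies in the \<open>N\<close>-fold product of \<open>Uset P\<close> only
  concerns the entries below \<open>N\<close>; the others do not enter the objective.
\<close>

definition mpc_feasible ::
  "('nx::finite, 'nu::finite, 'nt::finite, 'nw::finite, 'ny::finite) mpc_data
    \<Rightarrow> nat \<Rightarrow> real^'nt
    \<Rightarrow> ((nat \<Rightarrow> real^'nu) \<times> (real^'nx) \<times> (real^'nu) \<times> (real^'ny)) set" where
  "mpc_feasible P N \<theta> = ({..<N} \<rightarrow> Uset P) \<times> setpoints P \<theta>"

definition mpc_objective ::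
  "('nx::finite, 'nu::finite, 'nt::finite, 'nw::finite, 'ny::finite) mpc_data
    \<Rightarrow> nat \<Rightarrow> real \<Rightarrow> nat \<Rightarrow> real^'nx \<Rightarrow> real^'nt
    \<Rightarrow> (nat \<Rightarrow> real^'nu) \<times> (real^'nx) \<times> (real^'nu) \<times> (real^'ny) \<Rightarrow> real" where
  "mpc_objective P M \<omega> N x \<theta> =
     (\<lambda>(u, xs, us, ys).
        horizon_cost P M \<omega> N x \<theta> u xs us + (wnorm (Tmat P) (ys - ytarget P))\<^sup>2)"

definition mpc_minimizer ::
  "('nx::finite, 'nu::finite, 'nt::finite, 'nw::finite, 'ny::finite) mpc_data
    \<Rightarrow> nat \<Rightarrow> real \<Rightarrow> nat \<Rightarrow> real^'nx \<Rightarrow> real^'nt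
    \<Rightarrow> (nat \<Rightarrow> real^'nu) \<times> (real^'nx) \<times> (real^'nu) \<times> (real^'ny) \<Rightarrow> bool" where
  "mpc_minimizer P M \<omega> N x \<theta> s \<longleftrightarrow>
     is_arg_min (mpc_objective P M \<omega> N x \<theta>) (\<lambda>s. s \<in> mpc_feasible P N \<theta>) s"

text \<open>The infimum is the minimum whenever a minimizer exists.\<close>

definition mpc_value ::
  "('nx::finite, 'nu::finite, 'nt::finite, 'nw::finite, 'ny::finite) mpc_data
    \<Rightarrow> nat \<Rightarrow> real \<Rightarrow> nat \<Rightarrow> real^'nx \<Rightarrow> real^'nt
    \<Rightarrow> real" where
  "mpc_value P M \<omega> N x \<theta> = (INF s\<in>mpc_feasible P N \<theta>. mpc_objective P M \<omega> N x \<theta> s)"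

end

theory Submission
  imports Defs
begin

text \<open>
  By linearity in the parameter, \<open>w_err + x_err\<close> is the deviation of the next state estimate from the nominal
  successor of the current one under the estimated parameter. Two bounds on the optimal value \<open>V\<close>
  suffice. First, \<open>V\<close> is dominated by the stage cost at the optimal artificial setpoint, so the
  assumed decrease is a contraction by some factor \<open>q < 1\<close>. Secondly, for every \<open>\<epsilon> > 0\<close>, a change of the
  state and the parameter from \<open>(x, \<theta>)\<close> to \<open>(x', \<theta>')\<close> raises \<open>V\<close> to at most
  \<open>(1 + \<epsilon>) V + C (\<parallel>x' - x\<parallel>\<^sup>2 + \<parallel>\<theta>' - \<theta>\<parallel>\<^sup>2)\<close>: reuse the optimal inputs together with a nearby setpoint for
  the new parameter. Choosing \<open>\<epsilon>\<close> with \<open>(1 + \<epsilon>) q < 1\<close> combines them.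
\<close>

section \<open>Weighted norms\<close>

text \<open>Young's inequality, from the nonnegative square of \<open>\<epsilon> * a - b\<close>
  divided by \<epsilon>. Keeping \<epsilon> free lets the factor on the main term approach 1, at the
  price of a large factor on the error term.\<close>

lemma square_add_le:
  fixes a b \<epsilon> :: real
  assumes "0 < \<epsilon>"
  shows "(a + b)\<^sup>2 \<le> (1 + \<epsilon>) * a\<^sup>2 + (1 + 1 / \<epsilon>) * b\<^sup>2"
proof -
  have "0 \<le> (\<epsilon> * a - b)\<^sup>2 / \<epsilon>"
    using assms by simp
  also have "\<dots> = (1 + \<epsilon>) * a\<^sup>2 + (1 + 1 / \<epsilon>) * b\<^sup>2 - (a + b)\<^sup>2"
    using assms by (simp add: field_simps power2_eq_square)
  finally show ?thesis
    by simp
qed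

lemma wnorm_square:
  assumes "pos_def A"
  shows "(wnorm A z)\<^sup>2 = z \<bullet> (A *v z)"
proof -
  have "0 \<le> z \<bullet> (A *v z)"
    using assms by (cases "z = 0") (auto simp: pos_def_def intro: less_imp_le)
  then show ?thesis
    by (simp add: wnorm_def)
qed

lemma wnorm_zero [simp]: "wnorm A 0 = 0"
  by (simp add: wnorm_def)

lemma wnorm_scaleR_square:
  assumes "pos_def A"
  shows "(wnorm A (c *\<^sub>R z))\<^sup>2 = c\<^sup>2 * (wnorm A z)\<^sup>2"
  unfolding wnorm_square[OF assms] by (simp add: matrix_vector_mult_scaleR power2_eq_square)

lemma pos_def_inner_commute:
  assumes "pos_def A"
  shows "a \<bullet> (A *v b) = b \<bullet> (A *v a)"
  using assms by (metis dot_lmul_matrix inner_commute pos_def_def transpose_matrix_vector)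

text \<open>Young's inequality again, now in the inner product induced by \<open>A\<close>; symmetry
  of \<open>A\<close> merges the two cross terms.\<close>

lemma wnorm_add_square_le:
  assumes A: "pos_def A" and "0 < \<epsilon>"
  shows "(wnorm A (a + b))\<^sup>2 \<le> (1 + \<epsilon>) * (wnorm A a)\<^sup>2 + (1 + 1 / \<epsilon>) * (wnorm A b)\<^sup>2"
proof -
  have "0 \<le> (wnorm A (\<epsilon> *\<^sub>R a - b))\<^sup>2 / \<epsilon>"
    using \<open>0 < \<epsilon>\<close> by simp
  also have "\<dots> = (1 + \<epsilon>) * (wnorm A a)\<^sup>2 + (1 + 1 / \<epsilon>) * (wnorm A b)\<^sup>2 - (wnorm A (a + b))\<^sup>2"
    using \<open>0 < \<epsilon>\<close> pos_def_inner_commute[OF A, of a b]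
    by (simp add: wnorm_square[OF A] matrix_vector_mult_scaleR matrix_vector_mult_diff_distrib
        matrix_vector_right_distrib inner_add_left inner_add_right inner_diff_left inner_diff_right
        field_simps)
  finally show ?thesis
    by simp
qed

text \<open>On the compact unit sphere the quadratic form attains a positive minimum and a maximum;
  homogeneity carries both bounds to all vectors. One constant, the maximum plus the inverse of the
  minimum, serves both directions.\<close>

lemma wnorm_equiv_norm:
  fixes A :: "real^'n^'n"
  assumes A: "pos_def A"
  obtains K where "0 < K" "\<And>z. (wnorm A z)\<^sup>2 \<le> K * (norm z)\<^sup>2" "\<And>z. (norm z)\<^sup>2 \<le> K * (wnorm A z)\<^sup>2"
proof -
  let ?S = "sphere (0 :: real^'n) 1"
  let ?q = "\<lambda>z. z \<bullet> (A *v z)"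
  have cont: "continuous_on ?S ?q"
    by (intro continuous_intros matrix_vector_mult_linear_continuous_on)
  have ne: "?S \<noteq> {}"
    by simp
  obtain a where a: "a \<in> ?S" "\<forall>z\<in>?S. ?q a \<le> ?q z"
    using continuous_attains_inf[OF compact_sphere ne cont] by blast
  obtain b where b: "b \<in> ?S" "\<forall>z\<in>?S. ?q z \<le> ?q b"
    using continuous_attains_sup[OF compact_sphere ne cont] by blast
  have "a \<noteq> 0"
    using a(1) by auto
  then have "0 < ?q a"
    using A by (simp add: pos_def_def)
  have "b \<noteq> 0"
    using b(1) by auto
  then have "0 < ?q b"
    using A by (simp add: pos_def_def)
  have sandwich: "?q a * (norm z)\<^sup>2 \<le> (wnorm A z)\<^sup>2 \<and> (wnorm A z)\<^sup>2 \<le> ?q b * (norm z)\<^sup>2" for z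
  proof (cases "z = 0")
    case False
    let ?e = "inverse (norm z) *\<^sub>R z"
    have "?e \<in> ?S"
      using False by simp
    then have "?q a \<le> ?q ?e" "?q ?e \<le> ?q b"
      using a(2) b(2) by blast+
    moreover have "(wnorm A z)\<^sup>2 = (norm z)\<^sup>2 * ?q ?e"
      using False wnorm_scaleR_square[OF A, of "norm z" ?e] by (simp add: wnorm_square[OF A])
    ultimately show ?thesis
      by (metis mult.commute mult_left_mono zero_le_power2)
  qed simp
  show thesis
  proof
    show "0 < ?q b + 1 / ?q a"
      using \<open>0 < ?q a\<close> \<open>0 < ?q b\<close> by (simp add: add_pos_pos)
  next
    fix z :: "real^'n"
    have "?q b * (norm z)\<^sup>2 \<le> (?q b + 1 / ?q a) * (norm z)\<^sup>2"
      using \<open>0 < ?q a\<close> by (intro mult_right_mono) auto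
    then show "(wnorm A z)\<^sup>2 \<le> (?q b + 1 / ?q a) * (norm z)\<^sup>2"
      using sandwich[of z] by linarith
  next
    fix z :: "real^'n"
    have "(norm z)\<^sup>2 \<le> (1 / ?q a) * (wnorm A z)\<^sup>2"
      using sandwich[of z] \<open>0 < ?q a\<close> by (simp add: field_simps)
    also have "\<dots> \<le> (?q b + 1 / ?q a) * (wnorm A z)\<^sup>2"
      using \<open>0 < ?q b\<close> by (intro mult_right_mono) auto
    finally show "(norm z)\<^sup>2 \<le> (?q b + 1 / ?q a) * (wnorm A z)\<^sup>2" .
  qed
qed

section \<open>Costs of a regular, open-loop stable system\<close>

locale stable_mpc =
  fixes P :: "('nx::finite, 'nu::finite, 'nt::finite, 'nw::finite, 'ny::finite) mpc_data"
  assumes Q: "pos_def (Qmat P)" and R: "pos_def (Rmat P)" and T: "pos_def (Tmat P)"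
    and qxi: "\<And>i. i \<in> {1..ncon P} \<Longrightarrow> 0 < qxi P i"
    and regular: "regular P"
    and stable: "open_loop_exp_stable P"
begin

section \<open>Bounds and perturbation of the stage cost\<close>

lemma stage_cost_nonneg: "0 \<le> stage_cost P x u xs us"
  unfolding stage_cost_def using qxi by (auto intro!: add_nonneg_nonneg sum_nonneg simp: less_imp_le)

lemma terminal_cost_nonneg: "0 \<le> terminal_cost P M x xs us \<theta>"
  unfolding terminal_cost_def by (intro sum_nonneg stage_cost_nonneg)

lemma horizon_cost_nonneg: "0 \<le> \<omega> \<Longrightarrow> 0 \<le> horizon_cost P M \<omega> N x \<theta> u xs us"
  unfolding horizon_cost_def
  by (intro add_nonneg_nonneg sum_nonneg mult_nonneg_nonneg stage_cost_nonneg terminal_cost_nonneg)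

text \<open>The \<open>Qmat\<close> term alone already controls the state deviation, and the input
  and penalty terms are nonnegative. This later turns a distance to the setpoint into stage
  cost.\<close>

lemma norm_le_stage_cost:
  obtains K where "0 < K" "\<And>x u xs us. (norm (x - xs))\<^sup>2 \<le> K * stage_cost P x u xs us"
proof -
  obtain K where K: "0 < K" "\<And>z. (norm z)\<^sup>2 \<le> K * (wnorm (Qmat P) z)\<^sup>2"
    using wnorm_equiv_norm[OF Q] by metis
  have "(wnorm (Qmat P) (x - xs))\<^sup>2 \<le> stage_cost P x u xs us" for x u xs us
    unfolding stage_cost_def using qxi
    by (auto intro!: add_nonneg_nonneg sum_nonneg simp: less_imp_le add.assoc)
  with K that show thesis
    by (meson mult_left_mono less_imp_le order_trans)
qed

text \<open>The stage cost is a sum of squares of Lipschitz quantities, so Young's inequality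
  applies to each square separately with the same \<epsilon>.\<close>

lemma stage_cost_perturb:
  assumes "0 < \<epsilon>"
  obtains K where "0 < K"
    "\<And>x x' u u' xs xs' us us'. stage_cost P x' u' xs' us' \<le> (1 + \<epsilon>) * stage_cost P x u xs us
       + K * ((norm (x' - x))\<^sup>2 + (norm (u' - u))\<^sup>2 + (norm (xs' - xs))\<^sup>2 + (norm (us' - us))\<^sup>2)"
proof -
  let ?e = "1 + 1 / \<epsilon>"
  have e: "0 < ?e"
    using assms by (simp add: add_pos_pos)
  have diff: "(norm (a - b))\<^sup>2 \<le> 2 * ((norm a)\<^sup>2 + (norm b)\<^sup>2)" for a b :: "'b::real_normed_vector"
  proof -
    have "(norm (a - b))\<^sup>2 \<le> (norm a + norm b)\<^sup>2"
      by (intro power_mono norm_triangle_ineq4) simp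
    also have "\<dots> \<le> 2 * ((norm a)\<^sup>2 + (norm b)\<^sup>2)"
      using square_add_le[of 1 "norm a" "norm b"] by simp
    finally show ?thesis .
  qed
  \<comment> \<open>The new deviation \<open>a' - b'\<close> is the old one \<open>a - b\<close>
    plus \<open>(a' - a) - (b' - b)\<close>; only this second part enters the error.\<close>
  have wnorm: "(wnorm A (a' - b'))\<^sup>2 \<le> (1 + \<epsilon>) * (wnorm A (a - b))\<^sup>2
      + ?e * (K * (2 * ((norm (a' - a))\<^sup>2 + (norm (b' - b))\<^sup>2)))"
    if A: "pos_def A" and K: "0 < K" "\<And>z. (wnorm A z)\<^sup>2 \<le> K * (norm z)\<^sup>2"
    for A :: "real^'m^'m" and K a a' b b'
  proof -
    have "(wnorm A (a' - b'))\<^sup>2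
        \<le> (1 + \<epsilon>) * (wnorm A (a - b))\<^sup>2 + ?e * (wnorm A ((a' - a) - (b' - b)))\<^sup>2"
      using wnorm_add_square_le[OF A assms, of "a - b" "(a' - a) - (b' - b)"] by simp
    moreover have "(wnorm A ((a' - a) - (b' - b)))\<^sup>2
        \<le> K * (2 * ((norm (a' - a))\<^sup>2 + (norm (b' - b))\<^sup>2))"
      using K(2)[of "(a' - a) - (b' - b)"] diff[of "a' - a" "b' - b"] K(1)
      by (meson mult_left_mono less_imp_le order_trans)
    ultimately show ?thesis
      using e by (meson add_left_mono mult_left_mono less_imp_le order_trans)
  qed
  obtain KQ where KQ: "0 < KQ" "\<And>z. (wnorm (Qmat P) z)\<^sup>2 \<le> KQ * (norm z)\<^sup>2"
    using wnorm_equiv_norm[OF Q] by metis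
  obtain KR where KR: "0 < KR" "\<And>z. (wnorm (Rmat P) z)\<^sup>2 \<le> KR * (norm z)\<^sup>2"
    using wnorm_equiv_norm[OF R] by metis
  \<comment> \<open>By Cauchy-Schwarz each constraint residual is Lipschitz in the state with
    constant \<open>norm (Drow P i)\<close>, and truncation at 0 preserves this; \<open>KD\<close>
    is the weighted sum of the squared constants.\<close>
  define KD where "KD = (\<Sum>i=1..ncon P. qxi P i * (norm (Drow P i))\<^sup>2)"
  have KD: "0 \<le> KD"
    unfolding KD_def using qxi by (auto intro!: sum_nonneg simp: less_imp_le)
  have constr: "(\<Sum>i=1..ncon P. qxi P i * (max (Drow P i \<bullet> x' - dbnd P i) 0)\<^sup>2)
      \<le> (1 + \<epsilon>) * (\<Sum>i=1..ncon P. qxi P i * (max (Drow P i \<bullet> x - dbnd P i) 0)\<^sup>2)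
        + ?e * (KD * (norm (x' - x))\<^sup>2)" for x x'
  proof -
    have term_le: "qxi P i * (max (Drow P i \<bullet> x' - dbnd P i) 0)\<^sup>2
        \<le> (1 + \<epsilon>) * (qxi P i * (max (Drow P i \<bullet> x - dbnd P i) 0)\<^sup>2)
          + ?e * (qxi P i * (norm (Drow P i))\<^sup>2 * (norm (x' - x))\<^sup>2)" if i: "i \<in> {1..ncon P}" for i
    proof -
      let ?m = "max (Drow P i \<bullet> x - dbnd P i) 0" and ?n = "norm (Drow P i) * norm (x' - x)"
      have "Drow P i \<bullet> x' - Drow P i \<bullet> x \<le> ?n"
        using norm_cauchy_schwarz[of "Drow P i" "x' - x"] by (simp add: inner_diff_right)
      moreover have "0 \<le> ?n"
        by simp
      ultimately have "max (Drow P i \<bullet> x' - dbnd P i) 0 \<le> ?m + ?n"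
        by linarith
      then have "(max (Drow P i \<bullet> x' - dbnd P i) 0)\<^sup>2 \<le> (?m + ?n)\<^sup>2"
        by (intro power_mono) auto
      also have "\<dots> \<le> (1 + \<epsilon>) * ?m\<^sup>2 + ?e * ?n\<^sup>2"
        by (rule square_add_le[OF assms])
      finally have "qxi P i * (max (Drow P i \<bullet> x' - dbnd P i) 0)\<^sup>2
          \<le> qxi P i * ((1 + \<epsilon>) * ?m\<^sup>2 + ?e * ?n\<^sup>2)"
        using qxi[OF i] by (intro mult_left_mono) auto
      also have "\<dots> = (1 + \<epsilon>) * (qxi P i * ?m\<^sup>2)
          + ?e * (qxi P i * (norm (Drow P i))\<^sup>2 * (norm (x' - x))\<^sup>2)"
        by (simp add: distrib_left power_mult_distrib mult_ac)
      finally show ?thesis .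
    qed
    show ?thesis
      unfolding KD_def sum_distrib_left sum_distrib_right sum.distrib[symmetric]
      by (intro sum_mono term_le)
  qed
  \<comment> \<open>The \<open>KQ\<close> and \<open>KR\<close> errors carry a factor 2 from
    splitting a difference; \<open>KD\<close> receives the same factor so that one sum of squares
    collects all three.\<close>
  let ?K = "?e * (2 * (KQ + KR + KD))"
  show thesis
  proof
    show "0 < ?K"
      using e KQ(1) KR(1) KD by (intro mult_pos_pos) auto
  next
    fix x x' xs xs' :: "real^'nx" and u u' us us' :: "real^'nu"
    let ?a = "(norm (x' - x))\<^sup>2" and ?b = "(norm (u' - u))\<^sup>2"
      and ?c = "(norm (xs' - xs))\<^sup>2" and ?d = "(norm (us' - us))\<^sup>2"
    have step: "stage_cost P x' u' xs' us' \<le> (1 + \<epsilon>) * stage_cost P x u xs us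
        + ?e * (KQ * (2 * (?a + ?c)) + KR * (2 * (?b + ?d)) + KD * ?a)"
      unfolding stage_cost_def
      using wnorm[OF Q KQ, of x' xs' x xs] wnorm[OF R KR, of u' us' u us] constr[of x' x]
      by (simp only: distrib_left)
    have collect: "e * (p * (2 * s) + q * (2 * s) + r * (2 * s)) = e * (2 * (p + q + r)) * s"
      for e p q r s :: real
      by (simp add: algebra_simps)
    have parts: "KQ * (2 * (?a + ?c)) \<le> KQ * (2 * (?a + ?b + ?c + ?d))"
      "KR * (2 * (?b + ?d)) \<le> KR * (2 * (?a + ?b + ?c + ?d))"
      "KD * ?a \<le> KD * (2 * (?a + ?b + ?c + ?d))"
      using KQ(1) KR(1) KD by (auto intro!: mult_left_mono)
    have "?e * (KQ * (2 * (?a + ?c)) + KR * (2 * (?b + ?d)) + KD * ?a)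
        \<le> ?e * (KQ * (2 * (?a + ?b + ?c + ?d)) + KR * (2 * (?a + ?b + ?c + ?d))
          + KD * (2 * (?a + ?b + ?c + ?d)))"
      by (rule mult_left_mono[OF add_mono[OF add_mono[OF parts(1,2)] parts(3)]])
        (use e in simp)
    also have "\<dots> = ?K * (?a + ?b + ?c + ?d)"
      by (rule collect)
    finally show "stage_cost P x' u' xs' us'
        \<le> (1 + \<epsilon>) * stage_cost P x u xs us + ?K * (?a + ?b + ?c + ?d)"
      by (rule order_trans[OF step add_left_mono])
  qed
qed

text \<open>At \<open>x = xs\<close> with input \<open>us\<close> the stage cost vanishes, since the
  constraints hold there. Perturbing only the state away from \<open>xs\<close> therefore leaves
  just the quadratic error, and any \<epsilon>, here 1, will do.\<close>

lemma stage_cost_steady_input: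
  obtains K where "0 < K"
    "\<And>x xs us. xs \<in> Xset P \<Longrightarrow> stage_cost P x us xs us \<le> K * (norm (x - xs))\<^sup>2"
proof -
  obtain K where K: "0 < K"
    "\<And>x x' u u' xs xs' us us'. stage_cost P x' u' xs' us' \<le> (1 + 1) * stage_cost P x u xs us
       + K * ((norm (x' - x))\<^sup>2 + (norm (u' - u))\<^sup>2 + (norm (xs' - xs))\<^sup>2 + (norm (us' - us))\<^sup>2)"
    using stage_cost_perturb[of 1] zero_less_one by metis
  have "stage_cost P xs us xs us = 0" if "xs \<in> Xset P" for xs us
    using that by (auto simp: stage_cost_def Xset_def max_def intro!: sum.neutral)
  with K that show thesis
    by (metis (no_types, lifting) K(2) add_0 add.right_neutral diff_self mult_zero_right norm_zero
        zero_power2)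
qed

text \<open>Under the constant steady input, open-loop stability keeps every predicted state within
  a fixed multiple of the initial distance to \<open>xs\<close>, so each of the finitely many stage
  costs is quadratic in that distance. This makes the constant input a cheap candidate for the
  optimization.\<close>

lemma horizon_cost_steady_input:
  assumes "0 \<le> \<omega>"
  obtains K where "0 < K"
    "\<And>x \<theta> xs us ys. \<lbrakk>\<theta> \<in> Thetas P; (xs, us, ys) \<in> setpoints P \<theta>\<rbrakk>
       \<Longrightarrow> horizon_cost P M \<omega> N x \<theta> (\<lambda>_. us) xs us \<le> K * (norm (x - xs))\<^sup>2"
proof -
  obtain C \<rho> where C: "1 \<le> C" "0 < \<rho>" "\<rho> < 1"
    and decay: "\<And>\<theta> xs us x k. \<lbrakk>\<theta> \<in> Thetas P; us \<in> Uset P; xs = dyn P (xs, us, \<theta>, 0)\<rbrakk>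
      \<Longrightarrow> norm (pred_state P (\<lambda>_. us) k x \<theta> - xs) \<le> C * \<rho> ^ k * norm (x - xs)"
    using stable unfolding open_loop_exp_stable_def by fastforce
  obtain K where K: "0 < K"
    "\<And>x xs us. xs \<in> Xset P \<Longrightarrow> stage_cost P x us xs us \<le> K * (norm (x - xs))\<^sup>2"
    using stage_cost_steady_input by metis
  \<comment> \<open>Each predicted squared deviation costs a factor \<open>C\<^sup>2\<close>; the
    terminal cost has it twice because its prediction restarts from the state reached after
    \<open>N\<close> steps.\<close>
  let ?L = "real N * (K * C\<^sup>2) + \<omega> * (real M * (K * C\<^sup>2 * C\<^sup>2))"
  have bound: "horizon_cost P M \<omega> N x \<theta> (\<lambda>_. us) xs us \<le> ?L * (norm (x - xs))\<^sup>2"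
    if \<theta>: "\<theta> \<in> Thetas P" and s: "(xs, us, ys) \<in> setpoints P \<theta>" for x \<theta> xs us ys
  proof -
    have s: "us \<in> Uset P" "xs = dyn P (xs, us, \<theta>, 0)" "xs \<in> Xset P"
      using s by (auto simp: setpoints_def)
    have dist: "(norm (pred_state P (\<lambda>_. us) k x \<theta> - xs))\<^sup>2 \<le> C\<^sup>2 * (norm (x - xs))\<^sup>2" for x k
    proof -
      \<comment> \<open>Bounding \<open>\<rho> ^ k\<close> by 1 makes the estimate uniform in
        \<open>k\<close>.\<close>
      have "C * \<rho> ^ k * norm (x - xs) \<le> C * 1 * norm (x - xs)"
        using C by (intro mult_right_mono mult_left_mono power_le_one) auto
      then have "norm (pred_state P (\<lambda>_. us) k x \<theta> - xs) \<le> C * norm (x - xs)"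
        using decay[OF \<theta> s(1,2), of k x] by linarith
      then have "(norm (pred_state P (\<lambda>_. us) k x \<theta> - xs))\<^sup>2 \<le> (C * norm (x - xs))\<^sup>2"
        by (intro power_mono) auto
      then show ?thesis
        by (simp add: power_mult_distrib)
    qed
    have stage: "stage_cost P (pred_state P (\<lambda>_. us) k x \<theta>) us xs us
        \<le> K * C\<^sup>2 * (norm (x - xs))\<^sup>2" for x k
      using K(2)[OF s(3), of "pred_state P (\<lambda>_. us) k x \<theta>" us] mult_left_mono[OF dist[of k x], of K]
        K(1) unfolding mult.assoc by linarith
    let ?z = "pred_state P (\<lambda>_. us) N x \<theta>"
    have "(\<Sum>k<N. stage_cost P (pred_state P (\<lambda>_. us) k x \<theta>) us xs us)
        \<le> real N * (K * C\<^sup>2 * (norm (x - xs))\<^sup>2)"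
      using sum_bounded_above[of "{..<N}" _ "K * C\<^sup>2 * (norm (x - xs))\<^sup>2"] stage by simp
    moreover have "terminal_cost P M ?z xs us \<theta> \<le> real M * (K * C\<^sup>2 * (norm (?z - xs))\<^sup>2)"
      unfolding terminal_cost_def
      using sum_bounded_above[of "{..<M}" _ "K * C\<^sup>2 * (norm (?z - xs))\<^sup>2"] stage by simp
    then have "terminal_cost P M ?z xs us \<theta> \<le> real M * (K * C\<^sup>2 * (C\<^sup>2 * (norm (x - xs))\<^sup>2))"
      by (rule order_trans) (use K(1) dist in \<open>auto intro!: mult_left_mono\<close>)
    then have "\<omega> * terminal_cost P M ?z xs us \<theta>
        \<le> \<omega> * (real M * (K * C\<^sup>2 * (C\<^sup>2 * (norm (x - xs))\<^sup>2)))"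
      using assms by (intro mult_left_mono)
    ultimately show ?thesis
      unfolding horizon_cost_def by (simp add: algebra_simps)
  qed
  have "0 \<le> ?L"
    using assms K(1) by simp
  show thesis
  proof
    \<comment> \<open>\<open>?L\<close> is only known to be nonnegative; the added 1 secures strict
      positivity.\<close>
    show "0 < ?L + 1"
      using \<open>0 \<le> ?L\<close> by simp
  next
    fix x \<theta> xs us ys
    assume "\<theta> \<in> Thetas P" "(xs, us, ys) \<in> setpoints P \<theta>"
    from bound[OF this, of x]
    show "horizon_cost P M \<omega> N x \<theta> (\<lambda>_. us) xs us \<le> (?L + 1) * (norm (x - xs))\<^sup>2"
      by (rule order_trans) (intro mult_right_mono; simp)
  qed
qed

section \<open>Lipschitz dependence of predictions and horizon cost on the data\<close>

lemma dyn_lipschitz: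
  obtains L where "1 \<le> L"
    "\<And>x x' u u' \<theta> \<theta>'. \<lbrakk>u \<in> Uset P; u' \<in> Uset P; \<theta> \<in> Thetas P; \<theta>' \<in> Thetas P\<rbrakk> \<Longrightarrow>
       norm (dyn P (x', u', \<theta>', 0) - dyn P (x, u, \<theta>, 0))
         \<le> L * (norm (x' - x) + norm (u' - u) + norm (\<theta>' - \<theta>))"
proof -
  obtain L where L: "L-lipschitz_on (UNIV \<times> Uset P \<times> Thetas P \<times> UNIV) (dyn P)"
    using regular by (auto simp: regular_def)
  have "0 \<le> L"
    using L by (rule lipschitz_on_nonneg)
  \<comment> \<open>Raising the constant to \<open>L + 1\<close> makes it at least 1, so that powers
    of it grow with the prediction length.\<close>
  have "norm (dyn P (x', u', \<theta>', 0) - dyn P (x, u, \<theta>, 0))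
      \<le> (L + 1) * (norm (x' - x) + norm (u' - u) + norm (\<theta>' - \<theta>))"
    if "u \<in> Uset P" "u' \<in> Uset P" "\<theta> \<in> Thetas P" "\<theta>' \<in> Thetas P" for x x' u u' \<theta> \<theta>'
  proof -
    have "norm (dyn P (x', u', \<theta>', 0) - dyn P (x, u, \<theta>, 0))
        \<le> L * norm (x' - x, u' - u, \<theta>' - \<theta>, 0 :: real^'nw)"
      using lipschitz_onD[OF L, of "(x', u', \<theta>', 0)" "(x, u, \<theta>, 0)"] that
      by (simp add: dist_norm)
    also have "\<dots> \<le> (L + 1) * norm (x' - x, u' - u, \<theta>' - \<theta>, 0 :: real^'nw)"
      by (intro mult_right_mono) auto
    also have "norm (x' - x, u' - u, \<theta>' - \<theta>, 0 :: real^'nw)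
        \<le> norm (x' - x) + norm (u' - u) + norm (\<theta>' - \<theta>)"
      using norm_Pair_le[of "x' - x" "(u' - u, \<theta>' - \<theta>, 0 :: real^'nw)"]
        norm_Pair_le[of "u' - u" "(\<theta>' - \<theta>, 0 :: real^'nw)"]
        norm_Pair_le[of "\<theta>' - \<theta>" "0 :: real^'nw"] by simp
    finally show ?thesis
      using \<open>0 \<le> L\<close> by (simp add: mult_left_mono)
  qed
  with \<open>0 \<le> L\<close> show thesis
    by (intro that[of "L + 1"]) auto
qed

text \<open>Each step multiplies the accumulated error by at most \<open>L\<close> and adds fresh
  input and parameter errors. These never exceed the accumulated bound, so a factor
  \<open>2 * L\<close> per step absorbs both, and the power at \<open>n\<close> covers all shorter
  predictions.\<close>

lemma pred_state_lipschitz: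
  obtains K where "0 < K"
    "\<And>k x x' u u' \<theta> \<theta>' \<delta>. \<lbrakk>k \<le> n; \<And>i. i < k \<Longrightarrow> u i \<in> Uset P; \<And>i. i < k \<Longrightarrow> u' i \<in> Uset P;
       \<theta> \<in> Thetas P; \<theta>' \<in> Thetas P; 0 \<le> \<delta>; \<And>i. i < k \<Longrightarrow> norm (u' i - u i) \<le> \<delta>\<rbrakk> \<Longrightarrow>
       norm (pred_state P u' k x' \<theta>' - pred_state P u k x \<theta>)
         \<le> K * (norm (x' - x) + \<delta> + norm (\<theta>' - \<theta>))"
proof -
  obtain L where L: "1 \<le> L"
    "\<And>x x' u u' \<theta> \<theta>'. \<lbrakk>u \<in> Uset P; u' \<in> Uset P; \<theta> \<in> Thetas P; \<theta>' \<in> Thetas P\<rbrakk> \<Longrightarrow>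
       norm (dyn P (x', u', \<theta>', 0) - dyn P (x, u, \<theta>, 0))
         \<le> L * (norm (x' - x) + norm (u' - u) + norm (\<theta>' - \<theta>))"
    using dyn_lipschitz by metis
  have bound: "norm (pred_state P u' k x' \<theta>' - pred_state P u k x \<theta>)
      \<le> (2 * L) ^ k * (norm (x' - x) + \<delta> + norm (\<theta>' - \<theta>))"
    if "\<And>i. i < k \<Longrightarrow> u i \<in> Uset P" "\<And>i. i < k \<Longrightarrow> u' i \<in> Uset P"
      "\<theta> \<in> Thetas P" "\<theta>' \<in> Thetas P" "0 \<le> \<delta>" "\<And>i. i < k \<Longrightarrow> norm (u' i - u i) \<le> \<delta>"
    for k x x' u u' \<theta> \<theta>' \<delta>
    using that
  proof (induction k)
    case (Suc k)
    let ?S = "norm (x' - x) + \<delta> + norm (\<theta>' - \<theta>)"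
    let ?e = "norm (pred_state P u' k x' \<theta>' - pred_state P u k x \<theta>)"
    have IH: "?e \<le> (2 * L) ^ k * ?S"
      using Suc by simp
    have "1 \<le> (2 * L) ^ k"
      using L(1) by (intro one_le_power) simp
    then have S: "?S \<le> (2 * L) ^ k * ?S"
      using Suc.prems(5) mult_right_mono[of 1 "(2 * L) ^ k" ?S] by simp
    have "norm (pred_state P u' (Suc k) x' \<theta>' - pred_state P u (Suc k) x \<theta>)
        \<le> L * (?e + norm (u' k - u k) + norm (\<theta>' - \<theta>))"
      using L(2)[of "u k" "u' k" \<theta> \<theta>'] Suc.prems by simp
    also have "?e + norm (u' k - u k) + norm (\<theta>' - \<theta>) \<le> (2 * L) ^ k * ?S + ?S"
      using IH Suc.prems(6)[of k, OF lessI] norm_ge_zero[of "x' - x"] by linarith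
    also have "\<dots> \<le> 2 * ((2 * L) ^ k * ?S)"
      using S by linarith
    finally show ?case
      using L(1) by (simp add: mult_ac)
  qed simp
  show thesis
  proof
    show "0 < (2 * L) ^ n"
      using L(1) by simp
  next
    fix k x x' u u' \<theta> \<theta>' and \<delta> :: real
    assume "k \<le> n"
      and *: "\<And>i. i < k \<Longrightarrow> u i \<in> Uset P" "\<And>i. i < k \<Longrightarrow> u' i \<in> Uset P"
        "\<theta> \<in> Thetas P" "\<theta>' \<in> Thetas P" "0 \<le> \<delta>" "\<And>i. i < k \<Longrightarrow> norm (u' i - u i) \<le> \<delta>"
    then have "(2 * L) ^ k \<le> (2 * L) ^ n"
      using L(1) by (intro power_increasing) auto
    then show "norm (pred_state P u' k x' \<theta>' - pred_state P u k x \<theta>)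
        \<le> (2 * L) ^ n * (norm (x' - x) + \<delta> + norm (\<theta>' - \<theta>))"
      using bound[of k u u' \<theta> \<theta>' \<delta> x' x] *
      by (smt (verit) mult_right_mono norm_ge_zero)
  qed
qed

lemma pred_state_lipschitz_square:
  obtains K where "1 \<le> K"
    "\<And>k x x' u u' \<theta> \<theta>' \<delta>. \<lbrakk>k \<le> n; \<And>i. i < k \<Longrightarrow> u i \<in> Uset P; \<And>i. i < k \<Longrightarrow> u' i \<in> Uset P;
       \<theta> \<in> Thetas P; \<theta>' \<in> Thetas P; 0 \<le> \<delta>; \<And>i. i < k \<Longrightarrow> norm (u' i - u i) \<le> \<delta>\<rbrakk> \<Longrightarrow>
       (norm (pred_state P u' k x' \<theta>' - pred_state P u k x \<theta>))\<^sup>2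
         \<le> K * ((norm (x' - x))\<^sup>2 + \<delta>\<^sup>2 + (norm (\<theta>' - \<theta>))\<^sup>2)"
proof -
  obtain K where K: "0 < K"
    "\<And>k x x' u u' \<theta> \<theta>' \<delta>. \<lbrakk>k \<le> n; \<And>i. i < k \<Longrightarrow> u i \<in> Uset P; \<And>i. i < k \<Longrightarrow> u' i \<in> Uset P;
       \<theta> \<in> Thetas P; \<theta>' \<in> Thetas P; 0 \<le> \<delta>; \<And>i. i < k \<Longrightarrow> norm (u' i - u i) \<le> \<delta>\<rbrakk> \<Longrightarrow>
       norm (pred_state P u' k x' \<theta>' - pred_state P u k x \<theta>)
         \<le> K * (norm (x' - x) + \<delta> + norm (\<theta>' - \<theta>))"
    using pred_state_lipschitz[of n] by metis
  \<comment> \<open>The gap between the two sides is the sum of the squares of the three pairwise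
    differences.\<close>
  have three: "(a + b + c)\<^sup>2 \<le> 3 * (a\<^sup>2 + b\<^sup>2 + c\<^sup>2)" for a b c :: real
    using sum_squares_ge_zero[of "a - b" "b - c"] zero_le_power2[of "a - c"]
    by (simp add: power2_eq_square algebra_simps)
  show thesis
  proof
    show "1 \<le> 3 * K\<^sup>2 + 1"
      by simp
  next
    fix k x x' u u' \<theta> \<theta>' and \<delta> :: real
    assume "k \<le> n" "\<And>i. i < k \<Longrightarrow> u i \<in> Uset P" "\<And>i. i < k \<Longrightarrow> u' i \<in> Uset P"
      "\<theta> \<in> Thetas P" "\<theta>' \<in> Thetas P" "0 \<le> \<delta>" "\<And>i. i < k \<Longrightarrow> norm (u' i - u i) \<le> \<delta>"
    then have "norm (pred_state P u' k x' \<theta>' - pred_state P u k x \<theta>)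
        \<le> K * (norm (x' - x) + \<delta> + norm (\<theta>' - \<theta>))"
      by (rule K(2))
    then have "(norm (pred_state P u' k x' \<theta>' - pred_state P u k x \<theta>))\<^sup>2
        \<le> (K * (norm (x' - x) + \<delta> + norm (\<theta>' - \<theta>)))\<^sup>2"
      by (intro power_mono) auto
    also have "\<dots> \<le> K\<^sup>2 * (3 * ((norm (x' - x))\<^sup>2 + \<delta>\<^sup>2 + (norm (\<theta>' - \<theta>))\<^sup>2))"
      unfolding power_mult_distrib by (intro mult_left_mono three) simp
    also have "\<dots> \<le> (3 * K\<^sup>2 + 1) * ((norm (x' - x))\<^sup>2 + \<delta>\<^sup>2 + (norm (\<theta>' - \<theta>))\<^sup>2)"
      by (simp add: algebra_simps)
    finally show "(norm (pred_state P u' k x' \<theta>' - pred_state P u k x \<theta>))\<^sup>2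
        \<le> (3 * K\<^sup>2 + 1) * ((norm (x' - x))\<^sup>2 + \<delta>\<^sup>2 + (norm (\<theta>' - \<theta>))\<^sup>2)" .
  qed
qed

text \<open>The inputs \<open>u\<close> are kept, so over the horizon the predictions differ only
  through state and parameter. The terminal predictions start from the two resulting end states and
  use different constant inputs. Every stage cost in both phases is then perturbed with the same
  \<epsilon>.\<close>

lemma horizon_cost_perturb:
  assumes "0 < \<epsilon>" "0 \<le> \<omega>"
  obtains C where "0 < C"
    "\<And>x x' \<theta> \<theta>' u xs xs' us us'. \<lbrakk>\<theta> \<in> Thetas P; \<theta>' \<in> Thetas P; \<And>i. i < N \<Longrightarrow> u i \<in> Uset P;
       us \<in> Uset P; us' \<in> Uset P\<rbrakk> \<Longrightarrow>
       horizon_cost P M \<omega> N x' \<theta>' u xs' us' \<le> (1 + \<epsilon>) * horizon_cost P M \<omega> N x \<theta> u xs us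
         + C * ((norm (x' - x))\<^sup>2 + (norm (\<theta>' - \<theta>))\<^sup>2 + (norm (xs' - xs))\<^sup>2 + (norm (us' - us))\<^sup>2)"
proof -
  obtain K1 where K1: "1 \<le> K1"
    "\<And>k x x' u u' \<theta> \<theta>' \<delta>. \<lbrakk>k \<le> N + M; \<And>i. i < k \<Longrightarrow> u i \<in> Uset P; \<And>i. i < k \<Longrightarrow> u' i \<in> Uset P;
       \<theta> \<in> Thetas P; \<theta>' \<in> Thetas P; 0 \<le> \<delta>; \<And>i. i < k \<Longrightarrow> norm (u' i - u i) \<le> \<delta>\<rbrakk> \<Longrightarrow>
       (norm (pred_state P u' k x' \<theta>' - pred_state P u k x \<theta>))\<^sup>2
         \<le> K1 * ((norm (x' - x))\<^sup>2 + \<delta>\<^sup>2 + (norm (\<theta>' - \<theta>))\<^sup>2)"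
    using pred_state_lipschitz_square[of "N + M"] by metis
  obtain K2 where K2: "0 < K2"
    "\<And>x x' u u' xs xs' us us'. stage_cost P x' u' xs' us' \<le> (1 + \<epsilon>) * stage_cost P x u xs us
       + K2 * ((norm (x' - x))\<^sup>2 + (norm (u' - u))\<^sup>2 + (norm (xs' - xs))\<^sup>2 + (norm (us' - us))\<^sup>2)"
    using stage_cost_perturb[OF assms(1)] by metis
  \<comment> \<open>\<open>K1 * (K1 + 1)\<close> bounds the squared state deviation in either phase;
    the summand 2 pays once for the input deviation and once for the displaced setpoint.\<close>
  let ?K = "K1 * (K1 + 1) + 2"
  let ?C = "real N * (K2 * ?K) + \<omega> * (real M * (K2 * ?K))"
  have bound: "horizon_cost P M \<omega> N x' \<theta>' u xs' us' \<le> (1 + \<epsilon>) * horizon_cost P M \<omega> N x \<theta> u xs us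
      + ?C * ((norm (x' - x))\<^sup>2 + (norm (\<theta>' - \<theta>))\<^sup>2 + (norm (xs' - xs))\<^sup>2 + (norm (us' - us))\<^sup>2)"
    if \<theta>: "\<theta> \<in> Thetas P" "\<theta>' \<in> Thetas P" and u: "\<And>i. i < N \<Longrightarrow> u i \<in> Uset P"
      and us: "us \<in> Uset P" "us' \<in> Uset P"
    for x x' \<theta> \<theta>' u xs xs' us us'
  proof -
    define D where
      "D = (norm (x' - x))\<^sup>2 + (norm (\<theta>' - \<theta>))\<^sup>2 + (norm (xs' - xs))\<^sup>2 + (norm (us' - us))\<^sup>2"
    \<comment> \<open>The term \<open>0\<^sup>2\<close> is \<open>\<delta>\<^sup>2\<close> for
      identical input sequences, spelled out to match the prediction bound.\<close>
    have D_ge: "(norm (x' - x))\<^sup>2 + 0\<^sup>2 + (norm (\<theta>' - \<theta>))\<^sup>2 \<le> D"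
      "(norm (us' - us))\<^sup>2 + (norm (\<theta>' - \<theta>))\<^sup>2 \<le> D"
      "(norm (us' - us))\<^sup>2 \<le> D" "(norm (xs' - xs))\<^sup>2 + (norm (us' - us))\<^sup>2 \<le> D" "0 \<le> D"
      by (simp_all add: D_def)
    define E where "E = K2 * (?K * D)"
    let ?z = "\<lambda>k. pred_state P u k x \<theta>" and ?z' = "\<lambda>k. pred_state P u k x' \<theta>'"
    let ?t = "\<lambda>k. pred_state P (\<lambda>_. us) k (?z N) \<theta>"
      and ?t' = "\<lambda>k. pred_state P (\<lambda>_. us') k (?z' N) \<theta>'"
    have perturb: "stage_cost P a' b' xs' us' \<le> (1 + \<epsilon>) * stage_cost P a b xs us + E"
      if "(norm (a' - a))\<^sup>2 \<le> K1 * (K1 + 1) * D" "(norm (b' - b))\<^sup>2 \<le> D" for a a' b b'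
    proof -
      have "(norm (a' - a))\<^sup>2 + (norm (b' - b))\<^sup>2 + (norm (xs' - xs))\<^sup>2 + (norm (us' - us))\<^sup>2
          \<le> K1 * (K1 + 1) * D + 2 * D"
        using that D_ge(4) by linarith
      also have "\<dots> = ?K * D"
        by (rule distrib_right[symmetric])
      finally have "K2 * ((norm (a' - a))\<^sup>2 + (norm (b' - b))\<^sup>2 + (norm (xs' - xs))\<^sup>2
          + (norm (us' - us))\<^sup>2) \<le> E"
        unfolding E_def using K2(1) by (intro mult_left_mono) auto
      then show ?thesis
        by (rule order_trans[OF K2(2) add_left_mono])
    qed
    have z: "(norm (?z' k - ?z k))\<^sup>2 \<le> K1 * D" if "k \<le> N" for k
    proof -
      have "(norm (?z' k - ?z k))\<^sup>2 \<le> K1 * ((norm (x' - x))\<^sup>2 + 0\<^sup>2 + (norm (\<theta>' - \<theta>))\<^sup>2)"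
        using that u \<theta> by (intro K1(2)) auto
      also have "\<dots> \<le> K1 * D"
        using K1(1) D_ge(1) by (intro mult_left_mono) auto
      finally show ?thesis .
    qed
    \<comment> \<open>The prediction bound is used a second time, with the end-of-horizon deviation
      \<open>K1 * D\<close> as initial error and \<open>norm (us' - us)\<close> as the input
      deviation.\<close>
    have t: "(norm (?t' k - ?t k))\<^sup>2 \<le> K1 * (K1 + 1) * D" if "k \<le> M" for k
    proof -
      have "(norm (?t' k - ?t k))\<^sup>2
          \<le> K1 * ((norm (?z' N - ?z N))\<^sup>2 + (norm (us' - us))\<^sup>2 + (norm (\<theta>' - \<theta>))\<^sup>2)"
        using that us \<theta> by (intro K1(2)) auto
      also have "\<dots> \<le> K1 * (K1 * D + D)"
        using K1(1) z[OF order_refl] D_ge(2) by (intro mult_left_mono) linarith+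
      also have "\<dots> = K1 * (K1 + 1) * D"
        by (simp add: algebra_simps)
      finally show ?thesis .
    qed
    have "K1 * 1 \<le> K1 * (K1 + 1)"
      using K1(1) by (intro mult_left_mono) auto
    then have K1_le: "K1 * D \<le> K1 * (K1 + 1) * D"
      using D_ge(5) by (intro mult_right_mono) auto
    have "(\<Sum>k<N. stage_cost P (?z' k) (u k) xs' us')
        \<le> (\<Sum>k<N. (1 + \<epsilon>) * stage_cost P (?z k) (u k) xs us + E)"
      using D_ge(5) by (intro sum_mono perturb) (auto intro: order_trans[OF z K1_le])
    also have "\<dots> = (1 + \<epsilon>) * (\<Sum>k<N. stage_cost P (?z k) (u k) xs us) + real N * E"
      by (simp only: sum.distrib sum_distrib_left sum_constant card_lessThan)
    finally have stage: "(\<Sum>k<N. stage_cost P (?z' k) (u k) xs' us')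
        \<le> (1 + \<epsilon>) * (\<Sum>k<N. stage_cost P (?z k) (u k) xs us) + real N * E" .
    have "terminal_cost P M (?z' N) xs' us' \<theta>' \<le> (\<Sum>k<M. (1 + \<epsilon>) * stage_cost P (?t k) us xs us + E)"
      unfolding terminal_cost_def using t D_ge(3) by (intro sum_mono perturb) auto
    also have "\<dots> = (1 + \<epsilon>) * terminal_cost P M (?z N) xs us \<theta> + real M * E"
      unfolding terminal_cost_def
      by (simp only: sum.distrib sum_distrib_left sum_constant card_lessThan)
    finally have "\<omega> * terminal_cost P M (?z' N) xs' us' \<theta>'
        \<le> \<omega> * ((1 + \<epsilon>) * terminal_cost P M (?z N) xs us \<theta> + real M * E)"
      using assms(2) by (intro mult_left_mono)
    then have terminal: "\<omega> * terminal_cost P M (?z' N) xs' us' \<theta>'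
        \<le> (1 + \<epsilon>) * (\<omega> * terminal_cost P M (?z N) xs us \<theta>) + \<omega> * (real M * E)"
      by (simp only: distrib_left mult.left_commute)
    have "?C * D = real N * E + \<omega> * (real M * E)"
      unfolding E_def by (simp only: distrib_right[of _ _ D] mult.assoc)
    then show ?thesis
      using add_mono[OF stage terminal] unfolding horizon_cost_def D_def[symmetric]
      by (simp only: distrib_left[of "1 + \<epsilon>"] add_ac)
  qed
  have "0 \<le> ?C"
    using assms K1(1) K2(1) by simp
  show thesis
  proof
    show "0 < ?C + 1"
      using \<open>0 \<le> ?C\<close> by simp
  next
    fix x x' xs xs' :: "real^'nx" and \<theta> \<theta>' :: "real^'nt" and u and us us' :: "real^'nu"
    let ?D = "(norm (x' - x))\<^sup>2 + (norm (\<theta>' - \<theta>))\<^sup>2 + (norm (xs' - xs))\<^sup>2 + (norm (us' - us))\<^sup>2"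
    assume "\<theta> \<in> Thetas P" "\<theta>' \<in> Thetas P" "\<And>i. i < N \<Longrightarrow> u i \<in> Uset P" "us \<in> Uset P" "us' \<in> Uset P"
    then have "horizon_cost P M \<omega> N x' \<theta>' u xs' us'
        \<le> (1 + \<epsilon>) * horizon_cost P M \<omega> N x \<theta> u xs us + ?C * ?D"
      by (rule bound)
    also have "?C * ?D \<le> (?C + 1) * ?D"
      by (intro mult_right_mono) auto
    finally show "horizon_cost P M \<omega> N x' \<theta>' u xs' us'
        \<le> (1 + \<epsilon>) * horizon_cost P M \<omega> N x \<theta> u xs us + (?C + 1) * ?D"
      by simp
  qed
qed

end

section \<open>Displacing the artificial setpoint\<close>

text \<open>Fixes the witnesses of the setpoint conditions so that they can be named. The condition
  on optimal outputs enters as \<open>target\<close>: the target output is attained by some setpoint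
  for every parameter.\<close>

locale setpoint_mpc = stable_mpc P
  for P :: "('nx::finite, 'nu::finite, 'nt::finite, 'nw::finite, 'ny::finite) mpc_data" +
  fixes gx :: "real^'ny \<Rightarrow> real^'nt \<Rightarrow> real^'nx" and gu :: "real^'ny \<Rightarrow> real^'nt \<Rightarrow> real^'nu"
    and L_g L_s :: real
  assumes g: "\<And>\<theta> x u y. \<lbrakk>\<theta> \<in> Thetas P; (x, u, y) \<in> setpoints P \<theta>\<rbrakk> \<Longrightarrow> x = gx y \<theta> \<and> u = gu y \<theta>"
    and L_g: "0 \<le> L_g" "\<And>y y' \<theta> \<theta>'. \<lbrakk>\<theta> \<in> Thetas P; \<theta>' \<in> Thetas P\<rbrakk> \<Longrightarrow>
      (wnorm (Qmat P) (gx y \<theta> - gx y' \<theta>'))\<^sup>2 + (wnorm (Rmat P) (gu y \<theta> - gu y' \<theta>'))\<^sup>2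
        \<le> L_g * ((wnorm (Tmat P) (y - y'))\<^sup>2 + (norm (\<theta> - \<theta>'))\<^sup>2)"
    and segment: "\<And>\<theta> x1 u1 y1 x2 u2 y2 \<beta>. \<lbrakk>\<theta> \<in> Thetas P; (x1, u1, y1) \<in> setpoints P \<theta>;
      (x2, u2, y2) \<in> setpoints P \<theta>; \<beta> \<in> {0..1}\<rbrakk> \<Longrightarrow>
      (gx (\<beta> *\<^sub>R y1 + (1 - \<beta>) *\<^sub>R y2) \<theta>, gu (\<beta> *\<^sub>R y1 + (1 - \<beta>) *\<^sub>R y2) \<theta>, \<beta> *\<^sub>R y1 + (1 - \<beta>) *\<^sub>R y2)
        \<in> setpoints P \<theta>"
    and target: "\<And>\<theta>. \<theta> \<in> Thetas P \<Longrightarrow> \<exists>x u. (x, u, ytarget P) \<in> setpoints P \<theta>"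
    and L_s: "0 \<le> L_s" "\<And>\<theta> \<theta>' x u y.
      \<lbrakk>\<theta> \<in> Thetas P; \<theta>' \<in> Thetas P; (x, u, y) \<in> setpoints P \<theta>\<rbrakk> \<Longrightarrow>
      (INF (x', u', y')\<in>setpoints P \<theta>'. (wnorm (Tmat P) (y - y'))\<^sup>2) \<le> L_s * (norm (\<theta> - \<theta>'))\<^sup>2"
begin

text \<open>The condition on changing parameters controls outputs only; the Lipschitz maps
  \<open>gx\<close> and \<open>gu\<close> then transfer this closeness to states and inputs.\<close>

lemma nearby_setpoint:
  obtains C where "0 < C"
    "\<And>\<theta> \<theta>' x u y. \<lbrakk>\<theta> \<in> Thetas P; \<theta>' \<in> Thetas P; (x, u, y) \<in> setpoints P \<theta>\<rbrakk> \<Longrightarrow>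
       \<exists>(x', u', y')\<in>setpoints P \<theta>'. (norm (x' - x))\<^sup>2 \<le> C * (norm (\<theta>' - \<theta>))\<^sup>2
         \<and> (norm (u' - u))\<^sup>2 \<le> C * (norm (\<theta>' - \<theta>))\<^sup>2
         \<and> (wnorm (Tmat P) (y' - y))\<^sup>2 \<le> C * (norm (\<theta>' - \<theta>))\<^sup>2"
proof -
  obtain KQ where KQ: "0 < KQ" "\<And>z. (norm z)\<^sup>2 \<le> KQ * (wnorm (Qmat P) z)\<^sup>2"
    using wnorm_equiv_norm[OF Q] by metis
  obtain KR where KR: "0 < KR" "\<And>z. (norm z)\<^sup>2 \<le> KR * (wnorm (Rmat P) z)\<^sup>2"
    using wnorm_equiv_norm[OF R] by metis
  \<comment> \<open>Of \<open>L_s + 2\<close>, the part \<open>L_s + 1\<close> bounds the output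
    displacement and the remaining 1 is the parameter change itself.\<close>
  let ?L = "L_g * (L_s + 2)"
  let ?C = "KQ * ?L + KR * ?L + (L_s + 1)"
  have L: "0 \<le> ?L"
    using L_g(1) L_s(1) by simp
  have swap: "(wnorm (Tmat P) (a - b))\<^sup>2 = (wnorm (Tmat P) (b - a))\<^sup>2" for a b
    using wnorm_scaleR_square[OF T, of "- 1" "a - b"] by simp
  show thesis
  proof
    show "0 < ?C"
      using L L_s(1) KQ(1) KR(1) by (simp add: add_nonneg_pos)
  next
    fix \<theta> \<theta>' x u y
    assume \<theta>: "\<theta> \<in> Thetas P" "\<theta>' \<in> Thetas P" and s: "(x, u, y) \<in> setpoints P \<theta>"
    let ?d = "(norm (\<theta>' - \<theta>))\<^sup>2"
    \<comment> \<open>The slack from \<open>L_s\<close> to \<open>L_s + 1\<close> yields a point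
      near the infimum without its being attained. For equal parameters the slack vanishes, but the
      old setpoint itself serves.\<close>
    have "\<exists>(x', u', y')\<in>setpoints P \<theta>'. (wnorm (Tmat P) (y' - y))\<^sup>2 \<le> (L_s + 1) * ?d"
    proof (cases "\<theta>' = \<theta>")
      case True
      then show ?thesis
        using s by (intro bexI[of _ "(x, u, y)"]) auto
    next
      case False
      show ?thesis
      proof (rule ccontr)
        assume "\<not> ?thesis"
        then have far: "\<And>x' u' y'. (x', u', y') \<in> setpoints P \<theta>'
            \<Longrightarrow> (L_s + 1) * ?d \<le> (wnorm (Tmat P) (y - y'))\<^sup>2"
          by (fastforce simp: swap[of y])
        have "setpoints P \<theta>' \<noteq> {}"
          using regular \<theta>(2) by (auto simp: regular_def)
        then have "(L_s + 1) * ?d \<le> (INF (x', u', y')\<in>setpoints P \<theta>'. (wnorm (Tmat P) (y - y'))\<^sup>2)"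
          by (rule cINF_greatest) (auto intro: far)
        also have "\<dots> \<le> L_s * ?d"
          using L_s(2)[OF \<theta> s] by (simp add: norm_minus_commute)
        finally show False
          using False by (simp add: distrib_right)
      qed
    qed
    then obtain x' u' y' where s': "(x', u', y') \<in> setpoints P \<theta>'"
      and y': "(wnorm (Tmat P) (y' - y))\<^sup>2 \<le> (L_s + 1) * ?d"
      by blast
    have "(wnorm (Qmat P) (x' - x))\<^sup>2 + (wnorm (Rmat P) (u' - u))\<^sup>2
        \<le> L_g * ((wnorm (Tmat P) (y' - y))\<^sup>2 + ?d)"
      using L_g(2)[OF \<theta>(2,1), of y' y] g[OF \<theta>(1) s] g[OF \<theta>(2) s'] by simp
    also have "\<dots> \<le> L_g * ((L_s + 1) * ?d + ?d)"
      using L_g(1) y' by (intro mult_left_mono) auto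
    also have "\<dots> = ?L * ?d"
      by (simp add: algebra_simps)
    finally have "(wnorm (Qmat P) (x' - x))\<^sup>2 + (wnorm (Rmat P) (u' - u))\<^sup>2 \<le> ?L * ?d" .
    then have "(wnorm (Qmat P) (x' - x))\<^sup>2 \<le> ?L * ?d" "(wnorm (Rmat P) (u' - u))\<^sup>2 \<le> ?L * ?d"
      by (smt (verit) zero_le_power2)+
    then have "(norm (x' - x))\<^sup>2 \<le> KQ * (?L * ?d)" "(norm (u' - u))\<^sup>2 \<le> KR * (?L * ?d)"
      using KQ KR by (meson mult_left_mono less_imp_le order_trans)+
    moreover have "?C * ?d = KQ * (?L * ?d) + KR * (?L * ?d) + (L_s + 1) * ?d"
      by (simp only: distrib_right[of _ _ ?d] mult.assoc)
    moreover have "0 \<le> KQ * (?L * ?d)" "0 \<le> KR * (?L * ?d)" "0 \<le> (L_s + 1) * ?d"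
      using KQ(1) KR(1) L L_s(1) by (auto intro!: mult_nonneg_nonneg)
    ultimately have "(norm (x' - x))\<^sup>2 \<le> ?C * ?d" "(norm (u' - u))\<^sup>2 \<le> ?C * ?d"
      "(wnorm (Tmat P) (y' - y))\<^sup>2 \<le> ?C * ?d"
      using y' by linarith+
    with s' show "\<exists>(x', u', y')\<in>setpoints P \<theta>'. (norm (x' - x))\<^sup>2 \<le> ?C * ?d
        \<and> (norm (u' - u))\<^sup>2 \<le> ?C * ?d \<and> (wnorm (Tmat P) (y' - y))\<^sup>2 \<le> ?C * ?d"
      by blast
  qed
qed

text \<open>A step of length \<beta> along the output segment stays among the setpoints. It moves
  the output by \<beta> times the gap, so by the Lipschitz bound the squared state displacement is
  of second order in \<beta>, while the remaining gap is scaled by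
  \<open>1 - \<beta>\<close>.\<close>

lemma setpoint_towards:
  obtains C where "0 < C"
    "\<And>\<theta> x u y xd ud yd \<beta>. \<lbrakk>\<theta> \<in> Thetas P; (x, u, y) \<in> setpoints P \<theta>; (xd, ud, yd) \<in> setpoints P \<theta>;
       0 \<le> \<beta>; \<beta> \<le> 1\<rbrakk> \<Longrightarrow>
       \<exists>(x', u', y')\<in>setpoints P \<theta>. (norm (x' - x))\<^sup>2 \<le> C * (\<beta>\<^sup>2 * (wnorm (Tmat P) (y - yd))\<^sup>2)
         \<and> (wnorm (Tmat P) (y' - yd))\<^sup>2 = (1 - \<beta>)\<^sup>2 * (wnorm (Tmat P) (y - yd))\<^sup>2"
proof -
  obtain KQ where KQ: "0 < KQ" "\<And>z. (norm z)\<^sup>2 \<le> KQ * (wnorm (Qmat P) z)\<^sup>2"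
    using wnorm_equiv_norm[OF Q] by metis
  show thesis
  proof
    show "0 < KQ * L_g + 1"
      using KQ(1) L_g(1) by (simp add: add_nonneg_pos)
  next
    fix \<theta> x u y xd ud yd and \<beta> :: real
    assume \<theta>: "\<theta> \<in> Thetas P" and s: "(x, u, y) \<in> setpoints P \<theta>" "(xd, ud, yd) \<in> setpoints P \<theta>"
      and \<beta>: "0 \<le> \<beta>" "\<beta> \<le> 1"
    let ?E = "(wnorm (Tmat P) (y - yd))\<^sup>2"
    \<comment> \<open>The weight \<beta> sits on the destination \<open>yd\<close>, hence the
      swapped order of the setpoints in the use of \<open>segment\<close>.\<close>
    let ?y = "\<beta> *\<^sub>R yd + (1 - \<beta>) *\<^sub>R y"
    have s': "(gx ?y \<theta>, gu ?y \<theta>, ?y) \<in> setpoints P \<theta>"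
      using \<beta> by (intro segment[OF \<theta> s(2,1)]) auto
    have "?y - y = (- \<beta>) *\<^sub>R (y - yd)" "?y - yd = (1 - \<beta>) *\<^sub>R (y - yd)"
      by (simp_all add: algebra_simps)
    then have E: "(wnorm (Tmat P) (?y - y))\<^sup>2 = \<beta>\<^sup>2 * ?E"
      "(wnorm (Tmat P) (?y - yd))\<^sup>2 = (1 - \<beta>)\<^sup>2 * ?E"
      using wnorm_scaleR_square[OF T, of "- \<beta>" "y - yd"] wnorm_scaleR_square[OF T, of "1 - \<beta>" "y - yd"]
      by (simp_all only: power2_minus)
    have "(wnorm (Qmat P) (gx ?y \<theta> - x))\<^sup>2 + (wnorm (Rmat P) (gu ?y \<theta> - gu y \<theta>))\<^sup>2 \<le> L_g * (\<beta>\<^sup>2 * ?E)"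
      using L_g(2)[OF \<theta> \<theta>, of ?y y] g[OF \<theta> s(1)] unfolding E(1) by simp
    then have "(wnorm (Qmat P) (gx ?y \<theta> - x))\<^sup>2 \<le> L_g * (\<beta>\<^sup>2 * ?E)"
      by (smt (verit) zero_le_power2)
    then have "(norm (gx ?y \<theta> - x))\<^sup>2 \<le> KQ * (L_g * (\<beta>\<^sup>2 * ?E))"
      using KQ by (meson mult_left_mono less_imp_le order_trans)
    also have "\<dots> \<le> (KQ * L_g + 1) * (\<beta>\<^sup>2 * ?E)"
      by (simp add: distrib_right)
    finally show "\<exists>(x', u', y')\<in>setpoints P \<theta>. (norm (x' - x))\<^sup>2 \<le> (KQ * L_g + 1) * (\<beta>\<^sup>2 * ?E)
        \<and> (wnorm (Tmat P) (y' - yd))\<^sup>2 = (1 - \<beta>)\<^sup>2 * ?E"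
      using s' E(2) by (intro bexI[OF _ s']) simp
  qed
qed

section \<open>The optimal value\<close>

lemma mpc_objective_nonneg: "0 \<le> \<omega> \<Longrightarrow> 0 \<le> mpc_objective P M \<omega> N x \<theta> s"
  by (auto simp: mpc_objective_def horizon_cost_nonneg split: prod.split)

lemma mpc_value_le:
  assumes "0 \<le> \<omega>" "s \<in> mpc_feasible P N \<theta>"
  shows "mpc_value P M \<omega> N x \<theta> \<le> mpc_objective P M \<omega> N x \<theta> s"
  unfolding mpc_value_def
  by (rule cINF_lower[OF bdd_belowI2[of _ 0]]) (use assms mpc_objective_nonneg in auto)

lemma mpc_value_eq:
  assumes "0 \<le> \<omega>" "mpc_minimizer P M \<omega> N x \<theta> s"
  shows "mpc_value P M \<omega> N x \<theta> = mpc_objective P M \<omega> N x \<theta> s"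
proof (rule antisym)
  have s: "s \<in> mpc_feasible P N \<theta>"
    "\<And>t. t \<in> mpc_feasible P N \<theta> \<Longrightarrow> mpc_objective P M \<omega> N x \<theta> s \<le> mpc_objective P M \<omega> N x \<theta> t"
    using assms(2) by (auto simp: mpc_minimizer_def is_arg_min_linorder)
  then show "mpc_value P M \<omega> N x \<theta> \<le> mpc_objective P M \<omega> N x \<theta> s"
    using mpc_value_le[OF assms(1)] by blast
  show "mpc_objective P M \<omega> N x \<theta> s \<le> mpc_value P M \<omega> N x \<theta>"
    unfolding mpc_value_def using s by (intro cINF_greatest) auto
qed

text \<open>
  Moving the optimal artificial setpoint by a fraction \<open>\<beta>\<close> towards the target lowers the offset
  cost to first order in \<open>\<beta>\<close>, but costs only a second-order term plus a multiple of the stage cost.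
  Optimality therefore bounds the offset cost by the stage cost.
\<close>

lemma mpc_value_le_stage_cost:
  assumes \<omega>: "0 \<le> \<omega>"
  obtains C where "0 < C"
    "\<And>x \<theta> u xs us ys. \<lbrakk>\<theta> \<in> Thetas P; mpc_minimizer P M \<omega> N x \<theta> (u, xs, us, ys)\<rbrakk> \<Longrightarrow>
       mpc_value P M \<omega> N x \<theta> \<le> C * stage_cost P x (u 0) xs us"
proof -
  obtain K1 where K1: "0 < K1" "\<And>x u xs us. (norm (x - xs))\<^sup>2 \<le> K1 * stage_cost P x u xs us"
    using norm_le_stage_cost by metis
  obtain K2 where K2: "0 < K2"
    "\<And>x \<theta> xs us ys. \<lbrakk>\<theta> \<in> Thetas P; (xs, us, ys) \<in> setpoints P \<theta>\<rbrakk>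
       \<Longrightarrow> horizon_cost P M \<omega> N x \<theta> (\<lambda>_. us) xs us \<le> K2 * (norm (x - xs))\<^sup>2"
    using horizon_cost_steady_input[OF \<omega>, of M N] by metis
  obtain K3 where K3: "0 < K3"
    "\<And>\<theta> x u y xd ud yd \<beta>. \<lbrakk>\<theta> \<in> Thetas P; (x, u, y) \<in> setpoints P \<theta>; (xd, ud, yd) \<in> setpoints P \<theta>;
       0 \<le> \<beta>; \<beta> \<le> 1\<rbrakk> \<Longrightarrow>
       \<exists>(x', u', y')\<in>setpoints P \<theta>. (norm (x' - x))\<^sup>2 \<le> K3 * (\<beta>\<^sup>2 * (wnorm (Tmat P) (y - yd))\<^sup>2)
         \<and> (wnorm (Tmat P) (y' - yd))\<^sup>2 = (1 - \<beta>)\<^sup>2 * (wnorm (Tmat P) (y - yd))\<^sup>2"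
    by (rule setpoint_towards) blast
  \<comment> \<open>With this choice the second-order loss
    \<open>\<beta>\<^sup>2 * (1 + 2 * K2 * K3) * E\<close> equals \<open>\<beta> * E\<close>,
    exactly half of the first-order gain \<open>2 * \<beta> * E\<close>.\<close>
  define \<beta> where "\<beta> = 1 / (1 + 2 * K2 * K3)"
  have K23: "0 < K2 * K3"
    using K2(1) K3(1) by simp
  then have \<beta>: "0 < \<beta>" "\<beta> \<le> 1" and \<beta>_eq: "\<beta> * (1 + 2 * K2 * K3) = 1"
    by (simp_all add: \<beta>_def)
  let ?C = "(K2 + 2 * K2 / \<beta>) * K1"
  show thesis
  proof
    show "0 < ?C"
      using K1(1) K2(1) \<beta>(1) by (simp add: add_pos_pos)
  next
    fix x \<theta> u xs us ys
    assume \<theta>: "\<theta> \<in> Thetas P" and min: "mpc_minimizer P M \<omega> N x \<theta> (u, xs, us, ys)"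
    define E where "E = (wnorm (Tmat P) (ys - ytarget P))\<^sup>2"
    define r where "r = (norm (x - xs))\<^sup>2"
    let ?V = "mpc_value P M \<omega> N x \<theta>"
    \<comment> \<open>Holding the steady input of any setpoint is feasible, so every setpoint yields
      an upper bound on the value.\<close>
    have steady: "?V \<le> K2 * (norm (x - xs'))\<^sup>2 + (wnorm (Tmat P) (ys' - ytarget P))\<^sup>2"
      if s': "(xs', us', ys') \<in> setpoints P \<theta>" for xs' us' ys'
    proof -
      have "((\<lambda>_. us'), xs', us', ys') \<in> mpc_feasible P N \<theta>"
        using s' by (auto simp: mpc_feasible_def setpoints_def)
      from mpc_value_le[OF \<omega> this, of M x] K2(2)[OF \<theta> s', of x] show ?thesis
        by (simp add: mpc_objective_def)
    qed
    have s: "(xs, us, ys) \<in> setpoints P \<theta>"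
      using min by (auto simp: mpc_minimizer_def is_arg_min_def mpc_feasible_def)
    obtain xd ud where "(xd, ud, ytarget P) \<in> setpoints P \<theta>"
      using target[OF \<theta>] by blast
    from K3(2)[OF \<theta> s this, of \<beta>] \<beta> obtain xs' us' ys'
      where s': "(xs', us', ys') \<in> setpoints P \<theta>" "(norm (xs' - xs))\<^sup>2 \<le> K3 * (\<beta>\<^sup>2 * E)"
        "(wnorm (Tmat P) (ys' - ytarget P))\<^sup>2 = (1 - \<beta>)\<^sup>2 * E"
      unfolding E_def by auto
    have "(norm (x - xs'))\<^sup>2 \<le> (norm (x - xs) + norm (xs' - xs))\<^sup>2"
      using norm_triangle_ineq4[of "x - xs" "xs' - xs"] by (intro power_mono) auto
    also have "\<dots> \<le> 2 * r + 2 * (norm (xs' - xs))\<^sup>2"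
      using square_add_le[of 1 "norm (x - xs)" "norm (xs' - xs)"] by (simp add: r_def)
    also have "\<dots> \<le> 2 * r + 2 * (K3 * (\<beta>\<^sup>2 * E))"
      using s'(2) by simp
    finally have "K2 * (norm (x - xs'))\<^sup>2 \<le> K2 * (2 * r + 2 * (K3 * (\<beta>\<^sup>2 * E)))"
      using K2(1) by (intro mult_left_mono) auto
    then have V_le: "?V \<le> K2 * (2 * r + 2 * (K3 * (\<beta>\<^sup>2 * E))) + (1 - \<beta>)\<^sup>2 * E"
      using steady[OF s'(1)] s'(3) by linarith
    \<comment> \<open>The optimal value contains the offset cost \<open>E\<close>. Against the bound
      from the displaced setpoint this leaves an inequality in \<open>E\<close> and \<open>r\<close>
      alone.\<close>
    have "E \<le> ?V"
      using mpc_value_eq[OF \<omega> min] horizon_cost_nonneg[OF \<omega>]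
      by (simp add: mpc_objective_def E_def)
    with V_le have "E - (1 - \<beta>)\<^sup>2 * E - 2 * K2 * K3 * \<beta>\<^sup>2 * E \<le> 2 * K2 * r"
      by (simp add: algebra_simps)
    moreover have "E - (1 - \<beta>)\<^sup>2 * E - 2 * K2 * K3 * \<beta>\<^sup>2 * E
        = 2 * \<beta> * E - \<beta> * (1 + 2 * K2 * K3) * (\<beta> * E)"
      by (simp add: power2_eq_square algebra_simps)
    ultimately have "\<beta> * E \<le> 2 * K2 * r"
      unfolding \<beta>_eq by (simp add: mult.commute)
    then have "E \<le> 2 * K2 / \<beta> * r"
      using \<beta>(1) by (simp add: field_simps)
    \<comment> \<open>Now \<open>steady\<close> is applied at the optimal setpoint itself, with its
      offset replaced by the bound just found.\<close>
    then have "?V \<le> (K2 + 2 * K2 / \<beta>) * r"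
      using steady[OF s] unfolding E_def[symmetric] r_def[symmetric] by (simp add: distrib_right)
    also have "\<dots> \<le> (K2 + 2 * K2 / \<beta>) * (K1 * stage_cost P x (u 0) xs us)"
      unfolding r_def using K2(1) \<beta>(1) by (intro mult_left_mono K1(2)) (auto simp: add_nonneg_nonneg)
    finally show "?V \<le> ?C * stage_cost P x (u 0) xs us"
      by (simp only: mult.assoc)
  qed
qed

text \<open>The candidate for the new data is feasible because the input constraints depend on
  neither state nor parameter. Horizon and offset cost grow by the same factor
  \<open>1 + \<epsilon>\<close>, which can thus be pulled out to recover the old value.\<close>

lemma mpc_value_perturb:
  assumes \<omega>: "0 \<le> \<omega>" and \<epsilon>: "0 < \<epsilon>"
  obtains C where "0 < C"
    "\<And>x x' \<theta> \<theta>' s. \<lbrakk>\<theta> \<in> Thetas P; \<theta>' \<in> Thetas P; mpc_minimizer P M \<omega> N x \<theta> s\<rbrakk> \<Longrightarrow>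
       mpc_value P M \<omega> N x' \<theta>' \<le> (1 + \<epsilon>) * mpc_value P M \<omega> N x \<theta>
         + C * ((norm (x' - x))\<^sup>2 + (norm (\<theta>' - \<theta>))\<^sup>2)"
proof -
  obtain C1 where C1: "0 < C1"
    "\<And>x x' \<theta> \<theta>' u xs xs' us us'. \<lbrakk>\<theta> \<in> Thetas P; \<theta>' \<in> Thetas P; \<And>i. i < N \<Longrightarrow> u i \<in> Uset P;
       us \<in> Uset P; us' \<in> Uset P\<rbrakk> \<Longrightarrow>
       horizon_cost P M \<omega> N x' \<theta>' u xs' us' \<le> (1 + \<epsilon>) * horizon_cost P M \<omega> N x \<theta> u xs us
         + C1 * ((norm (x' - x))\<^sup>2 + (norm (\<theta>' - \<theta>))\<^sup>2 + (norm (xs' - xs))\<^sup>2 + (norm (us' - us))\<^sup>2)"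
    by (rule horizon_cost_perturb[OF \<epsilon> \<omega>, of N M]) blast
  obtain C2 where C2: "0 < C2"
    "\<And>\<theta> \<theta>' x u y. \<lbrakk>\<theta> \<in> Thetas P; \<theta>' \<in> Thetas P; (x, u, y) \<in> setpoints P \<theta>\<rbrakk> \<Longrightarrow>
       \<exists>(x', u', y')\<in>setpoints P \<theta>'. (norm (x' - x))\<^sup>2 \<le> C2 * (norm (\<theta>' - \<theta>))\<^sup>2
         \<and> (norm (u' - u))\<^sup>2 \<le> C2 * (norm (\<theta>' - \<theta>))\<^sup>2
         \<and> (wnorm (Tmat P) (y' - y))\<^sup>2 \<le> C2 * (norm (\<theta>' - \<theta>))\<^sup>2"
    by (rule nearby_setpoint) blast
  let ?e = "1 + 1 / \<epsilon>"
  \<comment> \<open>The first summand covers the horizon cost, where state and input of the setpoint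
    each contribute \<open>C2\<close>; the second covers the displaced output in the offset
    cost.\<close>
  let ?C = "C1 * (1 + 2 * C2) + ?e * C2"
  have e: "0 < ?e"
    using \<epsilon> by (simp add: add_pos_pos)
  show thesis
  proof
    show "0 < ?C"
      by (rule add_pos_pos[OF mult_pos_pos mult_pos_pos])
        (use C1(1) C2(1) \<epsilon> in \<open>simp_all add: add_pos_pos\<close>)
  next
    fix x x' :: "real^'nx" and \<theta> \<theta>' :: "real^'nt" and s
    assume \<theta>: "\<theta> \<in> Thetas P" "\<theta>' \<in> Thetas P" and min: "mpc_minimizer P M \<omega> N x \<theta> s"
    obtain u xs us ys where s_eq: "s = (u, xs, us, ys)"
      by (cases s)
    have u: "\<And>i. i < N \<Longrightarrow> u i \<in> Uset P" and s: "(xs, us, ys) \<in> setpoints P \<theta>"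
      using min unfolding s_eq by (auto simp: mpc_minimizer_def is_arg_min_def mpc_feasible_def)
    define a d where "a = (norm (x' - x))\<^sup>2" and "d = (norm (\<theta>' - \<theta>))\<^sup>2"
    obtain xs' us' ys' where s': "(xs', us', ys') \<in> setpoints P \<theta>'"
      "(norm (xs' - xs))\<^sup>2 \<le> C2 * d" "(norm (us' - us))\<^sup>2 \<le> C2 * d"
      "(wnorm (Tmat P) (ys' - ys))\<^sup>2 \<le> C2 * d"
      using C2(2)[OF \<theta> s] unfolding d_def by blast
    have "us \<in> Uset P" "us' \<in> Uset P"
      using s s'(1) by (auto simp: setpoints_def)
    from C1(2)[where u = u and x = x and x' = x' and xs = xs and xs' = xs', OF \<theta> u this]
    have "horizon_cost P M \<omega> N x' \<theta>' u xs' us' \<le> (1 + \<epsilon>) * horizon_cost P M \<omega> N x \<theta> u xs us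
        + C1 * (a + d + (norm (xs' - xs))\<^sup>2 + (norm (us' - us))\<^sup>2)"
      unfolding a_def d_def .
    also have "\<dots> \<le> (1 + \<epsilon>) * horizon_cost P M \<omega> N x \<theta> u xs us + C1 * (a + d + C2 * d + C2 * d)"
      using C1(1) s'(2,3) by (intro add_left_mono mult_left_mono add_mono) auto
    finally have h: "horizon_cost P M \<omega> N x' \<theta>' u xs' us'
        \<le> (1 + \<epsilon>) * horizon_cost P M \<omega> N x \<theta> u xs us + C1 * (a + d + C2 * d + C2 * d)" .
    have "(wnorm (Tmat P) (ys' - ytarget P))\<^sup>2
        \<le> (1 + \<epsilon>) * (wnorm (Tmat P) (ys - ytarget P))\<^sup>2 + ?e * (wnorm (Tmat P) (ys' - ys))\<^sup>2"
      using wnorm_add_square_le[OF T \<epsilon>, of "ys - ytarget P" "ys' - ys"] by simp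
    also have "\<dots> \<le> (1 + \<epsilon>) * (wnorm (Tmat P) (ys - ytarget P))\<^sup>2 + ?e * (C2 * d)"
      using e s'(4) by (intro add_left_mono mult_left_mono) auto
    finally have y: "(wnorm (Tmat P) (ys' - ytarget P))\<^sup>2
        \<le> (1 + \<epsilon>) * (wnorm (Tmat P) (ys - ytarget P))\<^sup>2 + ?e * (C2 * d)" .
    have "(u, xs', us', ys') \<in> mpc_feasible P N \<theta>'"
      using u s'(1) by (auto simp: mpc_feasible_def)
    from mpc_value_le[OF \<omega> this, of M x'] have "mpc_value P M \<omega> N x' \<theta>'
        \<le> horizon_cost P M \<omega> N x' \<theta>' u xs' us' + (wnorm (Tmat P) (ys' - ytarget P))\<^sup>2"
      by (simp add: mpc_objective_def)
    also have "\<dots> \<le> ((1 + \<epsilon>) * horizon_cost P M \<omega> N x \<theta> u xs us + C1 * (a + d + C2 * d + C2 * d))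
        + ((1 + \<epsilon>) * (wnorm (Tmat P) (ys - ytarget P))\<^sup>2 + ?e * (C2 * d))"
      by (rule add_mono[OF h y])
    also have "\<dots> = (1 + \<epsilon>) * mpc_value P M \<omega> N x \<theta> + (C1 * (a + d + C2 * d + C2 * d) + ?e * (C2 * d))"
      unfolding mpc_value_eq[OF \<omega> min] s_eq mpc_objective_def
      by (simp only: prod.case distrib_left[of "1 + \<epsilon>"] add_ac)
    also have "C1 * (a + d + C2 * d + C2 * d) \<le> C1 * (1 + 2 * C2) * (a + d)"
      using C1(1) C2(1) by (simp add: algebra_simps a_def)
    also have "?e * (C2 * d) \<le> ?e * C2 * (a + d)"
      unfolding mult.assoc using e C2(1) by (intro mult_left_mono) (auto simp: a_def)
    finally show "mpc_value P M \<omega> N x' \<theta>' \<le> (1 + \<epsilon>) * mpc_value P M \<omega> N x \<theta>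
        + ?C * ((norm (x' - x))\<^sup>2 + (norm (\<theta>' - \<theta>))\<^sup>2)"
      unfolding a_def[symmetric] d_def[symmetric] by (simp only: distrib_right[of _ _ "a + d"])
  qed
qed

end

section \<open>Combining the contraction with the perturbation bound\<close>

theorem theorem3:
  fixes P :: "('nx::finite, 'nu::finite, 'nt::finite, 'nw::finite, 'ny::finite) mpc_data"
    and G :: "real^'nx \<Rightarrow> real^'nu \<Rightarrow> real^'nw \<Rightarrow> real^'nt^'nx"
    and xrd :: "real^'nt \<Rightarrow> real^'nx"
    and urd :: "real^'nt \<Rightarrow> real^'nu"
    and yrd :: "real^'nt \<Rightarrow> real^'ny"
    and \<omega> :: real and M N :: nat
    and ustar :: "real^'nx \<Rightarrow> real^'nt \<Rightarrow> nat \<Rightarrow> real^'nu"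
    and xs :: "real^'nx \<Rightarrow> real^'nt \<Rightarrow> real^'nx"
    and us :: "real^'nx \<Rightarrow> real^'nt \<Rightarrow> real^'nu"
    and ys :: "real^'nx \<Rightarrow> real^'nt \<Rightarrow> real^'ny"
    and \<pi> :: "real^'nx \<Rightarrow> real^'nt \<Rightarrow> real^'nu"
  assumes weights: "pos_def (Qmat P)" "pos_def (Rmat P)" "pos_def (Tmat P)"
      "\<forall>i\<in>{1..ncon P}. 0 < qxi P i"
    and rd: "\<forall>\<theta>\<in>Thetas P. optimal_setpoint P \<theta> (xrd \<theta>, urd \<theta>, yrd \<theta>)"
    and regular: "regular P"
    and linear: "linearly_parametrized P G"
    and stable: "open_loop_exp_stable P"
    and setpoint: "setpoint_conditions P yrd"
    and horizon: "1 \<le> \<omega>" "1 \<le> M" "1 \<le> N"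
    and minimizer: "\<forall>x. \<forall>\<theta>\<in>Thetas P.
      mpc_minimizer P M \<omega> N x \<theta> (ustar x \<theta>, xs x \<theta>, us x \<theta>, ys x \<theta>)"
    and policy: "\<forall>x. \<forall>\<theta>\<in>Thetas P. \<pi> x \<theta> = ustar x \<theta> 0"
    and decrease: "\<exists>\<alpha>>0. \<forall>x. \<forall>\<theta>\<in>Thetas P.
      mpc_value P M \<omega> N (dyn P (x, \<pi> x \<theta>, \<theta>, 0)) \<theta> - mpc_value P M \<omega> N x \<theta>
        \<le> - \<alpha> * stage_cost P x (\<pi> x \<theta>) (xs x \<theta>) (us x \<theta>)"
  shows "\<exists>\<rho>\<^sub>V\<in>{0<..<1}. \<exists>c\<^sub>V>0.
    \<forall>(\<theta>hat :: nat \<Rightarrow> real^'nt) (\<theta> :: nat \<Rightarrow> real^'nt) (w :: nat \<Rightarrow> real^'nw)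
      (v :: nat \<Rightarrow> real^'nx) (x :: nat \<Rightarrow> real^'nx) (u :: nat \<Rightarrow> real^'nu)
      (xhat :: nat \<Rightarrow> real^'nx).
      (\<forall>k. \<theta>hat k \<in> Thetas P) \<and> (\<forall>k. \<theta> k \<in> Thetas P) \<and>
      (\<forall>k. x (Suc k) = dyn P (x k, u k, \<theta> k, w k)) \<and>
      (\<forall>k. u k = \<pi> (xhat k) (\<theta>hat k)) \<and>
      (\<forall>k. xhat k = x k + v k) \<longrightarrow>
      (\<forall>k. let x_err = G (xhat k) (u k) 0 *v (\<theta> k - \<theta>hat k);
               w_err = xhat (Suc k) - dyn P (xhat k, u k, \<theta> k, 0)
           in mpc_value P M \<omega> N (xhat (Suc k)) (\<theta>hat (Suc k))
              \<le> \<rho>\<^sub>V * mpc_value P M \<omega> N (xhat k) (\<theta>hat k)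
                + c\<^sub>V * ((norm (w_err + x_err))\<^sup>2 + (norm (\<theta>hat (Suc k) - \<theta>hat k))\<^sup>2))"
proof -
  interpret stable_mpc P
    using weights regular stable by unfold_locales auto
  have \<omega>: "0 \<le> \<omega>"
    using horizon(1) by simp
  from setpoint obtain gx gu L_g L_s where
    g: "\<forall>\<theta>\<in>Thetas P. \<forall>(x, u, y)\<in>setpoints P \<theta>. x = gx y \<theta> \<and> u = gu y \<theta>"
    and L_g: "0 \<le> L_g" "\<forall>y y'. \<forall>\<theta>\<in>Thetas P. \<forall>\<theta>'\<in>Thetas P.
      (wnorm (Qmat P) (gx y \<theta> - gx y' \<theta>'))\<^sup>2 + (wnorm (Rmat P) (gu y \<theta> - gu y' \<theta>'))\<^sup>2
        \<le> L_g * ((wnorm (Tmat P) (y - y'))\<^sup>2 + (norm (\<theta> - \<theta>'))\<^sup>2)"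
    and segment: "\<forall>\<theta>\<in>Thetas P. \<forall>(x1, u1, y1)\<in>setpoints P \<theta>. \<forall>(x2, u2, y2)\<in>setpoints P \<theta>.
      \<forall>\<beta>\<in>{0..1}. let y = \<beta> *\<^sub>R y1 + (1 - \<beta>) *\<^sub>R y2 in (gx y \<theta>, gu y \<theta>, y) \<in> setpoints P \<theta>"
    and yrd: "\<forall>\<theta>\<in>Thetas P. yrd \<theta> = ytarget P"
    and L_s: "0 \<le> L_s" "\<forall>\<theta>\<in>Thetas P. \<forall>\<theta>'\<in>Thetas P. \<forall>(xs, us, ys)\<in>setpoints P \<theta>.
      (INF (xs', us', ys')\<in>setpoints P \<theta>'. (wnorm (Tmat P) (ys - ys'))\<^sup>2) \<le> L_s * (norm (\<theta> - \<theta>'))\<^sup>2"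
    unfolding setpoint_conditions_def by (elim conjE exE) (rule that)
  interpret setpoint_mpc P gx gu L_g L_s
  proof
    fix \<theta> x1 u1 y1 x2 u2 y2 and \<beta> :: real
    assume "\<theta> \<in> Thetas P" "(x1, u1, y1) \<in> setpoints P \<theta>" and s: "(x2, u2, y2) \<in> setpoints P \<theta>"
      and \<beta>: "\<beta> \<in> {0..1}"
    then have "\<forall>(x2, u2, y2)\<in>setpoints P \<theta>. \<forall>\<beta>\<in>{0..1}.
        let y = \<beta> *\<^sub>R y1 + (1 - \<beta>) *\<^sub>R y2 in (gx y \<theta>, gu y \<theta>, y) \<in> setpoints P \<theta>"
      by (auto dest!: segment[THEN bspec, THEN bspec])
    from bspec[OF this s]
    show "(gx (\<beta> *\<^sub>R y1 + (1 - \<beta>) *\<^sub>R y2) \<theta>, gu (\<beta> *\<^sub>R y1 + (1 - \<beta>) *\<^sub>R y2) \<theta>,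
        \<beta> *\<^sub>R y1 + (1 - \<beta>) *\<^sub>R y2) \<in> setpoints P \<theta>"
      using \<beta> by (simp add: Let_def)
  next
    fix \<theta> x u y
    assume "\<theta> \<in> Thetas P" "(x, u, y) \<in> setpoints P \<theta>"
    from bspec[OF bspec[OF g this(1)] this(2)] show "x = gx y \<theta> \<and> u = gu y \<theta>"
      by simp
  next
    fix \<theta> \<theta>' x u y
    assume "\<theta> \<in> Thetas P" "\<theta>' \<in> Thetas P" "(x, u, y) \<in> setpoints P \<theta>"
    from bspec[OF bspec[OF bspec[OF L_s(2) this(1)] this(2)] this(3)]
    show "(INF (x', u', y')\<in>setpoints P \<theta>'. (wnorm (Tmat P) (y - y'))\<^sup>2) \<le> L_s * (norm (\<theta> - \<theta>'))\<^sup>2"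
      by simp
  next
    \<comment> \<open>The optimal setpoint belongs to \<open>setpoints P \<theta>\<close>, and its
      output is the target.\<close>
    fix \<theta>
    assume "\<theta> \<in> Thetas P"
    then show "\<exists>x u. (x, u, ytarget P) \<in> setpoints P \<theta>"
      using rd yrd by (auto simp: optimal_setpoint_def is_arg_min_def)
  qed (simp_all add: L_g L_s(1))
  obtain C where C: "0 < C"
    "\<And>x \<theta> u xs us ys. \<lbrakk>\<theta> \<in> Thetas P; mpc_minimizer P M \<omega> N x \<theta> (u, xs, us, ys)\<rbrakk> \<Longrightarrow>
       mpc_value P M \<omega> N x \<theta> \<le> C * stage_cost P x (u 0) xs us"
    by (rule mpc_value_le_stage_cost[OF \<omega>, of M N]) blast+
  obtain \<alpha> where \<alpha>: "0 < \<alpha>" "\<And>x \<theta>. \<theta> \<in> Thetas P \<Longrightarrow>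
      mpc_value P M \<omega> N (dyn P (x, \<pi> x \<theta>, \<theta>, 0)) \<theta> - mpc_value P M \<omega> N x \<theta>
        \<le> - \<alpha> * stage_cost P x (\<pi> x \<theta>) (xs x \<theta>) (us x \<theta>)"
    using decrease by blast
  \<comment> \<open>The decrease together with the stage cost bound gives the factor
    \<open>1 - \<alpha> / C\<close>, which may fail to be positive; the maximum with
    \<open>1 / 2\<close> permits division by \<open>q\<close> below.\<close>
  define q where "q = max (1 / 2) (1 - \<alpha> / C)"
  have q: "0 < q" "q < 1"
    using \<alpha>(1) C(1) by (auto simp: q_def)
  have nominal: "mpc_value P M \<omega> N (dyn P (x, \<pi> x \<theta>, \<theta>, 0)) \<theta> \<le> q * mpc_value P M \<omega> N x \<theta>"
    if \<theta>: "\<theta> \<in> Thetas P" for x \<theta>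
  proof -
    let ?V = "mpc_value P M \<omega> N x \<theta>"
    have min: "mpc_minimizer P M \<omega> N x \<theta> (ustar x \<theta>, xs x \<theta>, us x \<theta>, ys x \<theta>)"
      using minimizer \<theta> by blast
    have "?V \<le> C * stage_cost P x (\<pi> x \<theta>) (xs x \<theta>) (us x \<theta>)"
      using C(2)[OF \<theta> min] policy \<theta> by simp
    then have "\<alpha> / C * ?V \<le> \<alpha> / C * (C * stage_cost P x (\<pi> x \<theta>) (xs x \<theta>) (us x \<theta>))"
      using \<alpha>(1) C(1) by (intro mult_left_mono) auto
    also have "\<dots> = \<alpha> * stage_cost P x (\<pi> x \<theta>) (xs x \<theta>) (us x \<theta>)"
      using C(1) by simp
    finally have "mpc_value P M \<omega> N (dyn P (x, \<pi> x \<theta>, \<theta>, 0)) \<theta> \<le> (1 - \<alpha> / C) * ?V"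
      using \<alpha>(2)[OF \<theta>, of x] by (simp add: left_diff_distrib)
    also have "\<dots> \<le> q * ?V"
      using mpc_value_eq[OF \<omega> min] mpc_objective_nonneg[OF \<omega>]
      by (intro mult_right_mono) (auto simp: q_def)
    finally show ?thesis .
  qed
  \<comment> \<open>Chosen so that \<open>(1 + \<epsilon>) * q\<close> is the midpoint of
    \<open>q\<close> and 1.\<close>
  define \<epsilon> where "\<epsilon> = (1 - q) / (2 * q)"
  have \<epsilon>: "0 < \<epsilon>" and \<epsilon>_eq: "(1 + \<epsilon>) * q = (1 + q) / 2"
    using q by (simp_all add: \<epsilon>_def field_simps)
  obtain c where c: "0 < c"
    "\<And>x x' \<theta> \<theta>' s. \<lbrakk>\<theta> \<in> Thetas P; \<theta>' \<in> Thetas P; mpc_minimizer P M \<omega> N x \<theta> s\<rbrakk> \<Longrightarrow>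
       mpc_value P M \<omega> N x' \<theta>' \<le> (1 + \<epsilon>) * mpc_value P M \<omega> N x \<theta>
         + c * ((norm (x' - x))\<^sup>2 + (norm (\<theta>' - \<theta>))\<^sup>2)"
    by (rule mpc_value_perturb[OF \<omega> \<epsilon>, of M N]) blast
  \<comment> \<open>The value is perturbed around the nominal successor, where a minimizer for the
    old parameter exists; the nominal contraction then bounds the value at that point.\<close>
  have step: "mpc_value P M \<omega> N x' \<theta>' \<le> (1 + q) / 2 * mpc_value P M \<omega> N x \<theta>
      + c * ((norm (x' - dyn P (x, \<pi> x \<theta>, \<theta>, 0)))\<^sup>2 + (norm (\<theta>' - \<theta>))\<^sup>2)"
    if \<theta>: "\<theta> \<in> Thetas P" "\<theta>' \<in> Thetas P" for x x' \<theta> \<theta>'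
  proof -
    let ?x = "dyn P (x, \<pi> x \<theta>, \<theta>, 0)"
    have "mpc_value P M \<omega> N x' \<theta>'
        \<le> (1 + \<epsilon>) * mpc_value P M \<omega> N ?x \<theta> + c * ((norm (x' - ?x))\<^sup>2 + (norm (\<theta>' - \<theta>))\<^sup>2)"
      using minimizer \<theta> by (intro c(2)) auto
    also have "(1 + \<epsilon>) * mpc_value P M \<omega> N ?x \<theta> \<le> (1 + \<epsilon>) * (q * mpc_value P M \<omega> N x \<theta>)"
      using \<epsilon> by (intro mult_left_mono nominal \<theta>) auto
    also have "\<dots> = (1 + q) / 2 * mpc_value P M \<omega> N x \<theta>"
      by (simp only: mult.assoc[symmetric] \<epsilon>_eq)
    finally show ?thesis
      by simp
  qed
  \<comment> \<open>Both dynamics share the part with zero parameter, so the \<open>G\<close> term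
    exchanges \<theta> for \<theta>' in the prediction. The sum of the two errors is thus the
    deviation from the nominal successor under the estimate.\<close>
  have errors: "x' - dyn P (x, u, \<theta>, 0) + G x u 0 *v (\<theta> - \<theta>') = x' - dyn P (x, u, \<theta>', 0)"
    for x x' u \<theta> \<theta>'
    using linear[unfolded linearly_parametrized_def, rule_format, of x u \<theta> 0]
      linear[unfolded linearly_parametrized_def, rule_format, of x u \<theta>' 0]
    by (simp add: matrix_vector_mult_diff_distrib)
  show ?thesis
    by (intro bexI[of _ "(1 + q) / 2"] exI[of _ c] conjI allI impI)
      (use q c(1) step in \<open>auto simp: Let_def errors\<close>)
qed

end
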